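(* Let $k\geq 3$, and let $H$ be a covering $k$-hypergraph. Then $H$ is eulerian if and only if it has at least two edges.
   Context: A hypergraph $H=(V,E)$ has a non-empty finite vertex set $V$ and a finite collection $E$ of edges, each associated with a subset of $V$; parallel edges (distinct edges with the same vertex set) are allowed, so $E$ is a multiset of subsets of $V$ and edges are counted with multiplicity. A covering $k$-hypergraph is a hypergraph with at least one edge in which every edge has exactly $k$ vertices and every $(k-1)$-subset of the vertex set is contained in at least one edge. A walk is a sequence $v_0e_1v_1\dots v_{r-1}e_rv_r$ ($r\ge 0$) of vertices $v_i$ and edges $e_i$ such that $v_{i-1}\neq v_i$ and $v_{i-1},v_i\in e_i$ for all $i=1,\dots,r$; it is closed if $v_0=v_r$. It is a strict trail if $e_1,\dots,e_r$ are pairwise distinct edges. An Euler tour of $H$ is a closed strict trail traversing every edge of $H$ exactly once. $H$ is eulerian if it admits an Euler tour. *)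

theory Defs
  imports Main
begin

text \<open>
  Parallel edges are represented by labelling: an edge is a label \<open>e \<in> edges H\<close>, and
  \<open>ends H e\<close> is its vertex set. As \<open>ends H\<close> need not be injective, the vertex sets of the
  edges form a multiset, and \<open>card (edges H)\<close> counts edges with multiplicity.
\<close>

record ('v, 'e) pre_hypergraph =
  verts :: "'v set"
  edges :: "'e set"
  ends :: "'e \<Rightarrow> 'v set"

definition hypergraph :: "('v, 'e) pre_hypergraph \<Rightarrow> bool" where
  "hypergraph H \<longleftrightarrow>
     finite (verts H) \<and> verts H \<noteq> {} \<and> finite (edges H) \<and>
     (\<forall>e\<in>edges H. ends H e \<subseteq> verts H)"

definition covering_hypergraph :: "nat \<Rightarrow> ('v, 'e) pre_hypergraph \<Rightarrow> bool" where
  "covering_hypergraph k H \<longleftrightarrow>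
     hypergraph H \<and> edges H \<noteq> {} \<and>
     (\<forall>e\<in>edges H. card (ends H e) = k) \<and>
     (\<forall>S. S \<subseteq> verts H \<and> card S = k - 1 \<longrightarrow> (\<exists>e\<in>edges H. S \<subseteq> ends H e))"

text \<open>
  The walk $v_0 e_1 v_1 \dots e_r v_r$ is the pair of lists \<open>vs = [v\<^sub>0, \<dots>, v\<^sub>r]\<close> and
  \<open>es = [e\<^sub>1, \<dots>, e\<^sub>r]\<close>; lists are indexed from 0, so \<open>es ! i\<close> joins \<open>vs ! i\<close> to
  \<open>vs ! Suc i\<close>.
\<close>

definition walk :: "('v, 'e) pre_hypergraph \<Rightarrow> 'v list \<Rightarrow> 'e list \<Rightarrow> bool" where
  "walk H vs es \<longleftrightarrow>
     length vs = Suc (length es) \<and> set vs \<subseteq> verts H \<and> set es \<subseteq> edges H \<and>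
     (\<forall>i<length es. vs ! i \<noteq> vs ! Suc i \<and>
        vs ! i \<in> ends H (es ! i) \<and> vs ! Suc i \<in> ends H (es ! i))"

definition closed_walk :: "('v, 'e) pre_hypergraph \<Rightarrow> 'v list \<Rightarrow> 'e list \<Rightarrow> bool" where
  "closed_walk H vs es \<longleftrightarrow> walk H vs es \<and> hd vs = last vs"

definition strict_trail :: "('v, 'e) pre_hypergraph \<Rightarrow> 'v list \<Rightarrow> 'e list \<Rightarrow> bool" where
  "strict_trail H vs es \<longleftrightarrow> walk H vs es \<and> distinct es"

definition euler_tour :: "('v, 'e) pre_hypergraph \<Rightarrow> 'v list \<Rightarrow> 'e list \<Rightarrow> bool" where
  "euler_tour H vs es \<longleftrightarrow>
     closed_walk H vs es \<and> strict_trail H vs es \<and> (\<forall>e\<in>edges H. count_list es e = 1)"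

definition eulerian :: "('v, 'e) pre_hypergraph \<Rightarrow> bool" where
  "eulerian H \<longleftrightarrow> (\<exists>vs es. euler_tour H vs es)"

end

theory Submission imports Defs begin

text \<open>
  A single edge cannot carry a closed walk, since consecutive vertices of a walk differ. For the
  converse, deleting one vertex from each edge in a suitable way turns a covering \<open>k\<close>-hypergraph into
  a covering \<open>(k - 1)\<close>-hypergraph with the same number of edges (\<open>covering_shrink\<close>), and an Euler tour
  of the latter is also one of the former. So it suffices to treat a system of triples that covers
  every pair of vertices.

  There the task is to choose a pair of vertices from every triple in such a way that the resulting
  multigraph has even degrees and all its edges in one component; an Euler circuit of this
  multigraph is an Euler tour.

  Even degrees. Assign to the edges of a spanning tree on the vertices distinct triples, each
  containing the two ends of its tree edge. A triple \<open>{s, u, w}\<close> assigned to the tree edge \<open>su\<close> may use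
  \<open>{s, w}\<close> or \<open>{u, w}\<close>, and exchanging these two pairs toggles the parities of \<open>s\<close> and \<open>u\<close>. Thus, along
  paths of the tree, any two odd vertices can be made even. Such a tree with distinct triples is found
  greedily: as every pair is covered, a set \<open>S\<close> of reached vertices meets so many triples leading out
  of \<open>S\<close> that not all of them have been used (\<open>growing_step\<close>); only for the last vertex a triple has
  to be set aside in advance (\<open>even_choice_exists\<close>).

  Connectedness. Among all even choices, take one that has a component \<open>U\<close> with as many edges as
  possible, and suppose that it misses an edge. A triple that contains a vertex \<open>r\<close> outside \<open>U\<close> and a
  vertex \<open>b\<close> in \<open>U\<close> does not use the pair \<open>{r, b}\<close>, so its pair can be changed by the symmetric
  difference with \<open>{r, b}\<close>. Such flips along the edges of a short closed walk, with different
  triples, preserve all parities. They would enlarge \<open>U\<close> unless they cut it into pieces. The edges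
  inside \<open>U\<close> that are flipped then form a cut, and cuts of even graphs have even size. Playing off
  several cuts of this kind against each other produces a cut of odd size, unless some flip does enlarge
  \<open>U\<close>. This shows first that no
  triple is disjoint from \<open>U\<close> (\<open>triple_meets_U\<close>), so that the vertices outside \<open>U\<close> are pairwise
  adjacent and every triple containing two of them has its third vertex in \<open>U\<close>. The third vertices of
  two such triples at \<open>r\<close> are in turn contained in a triple with a vertex \<open>w\<close> outside \<open>U\<close>
  (\<open>apex_pair\<close>), and \<open>w\<close> determines every further edge at \<open>r\<close> (\<open>third_spoke\<close>); this is inconsistent
  (\<open>all_inside\<close>).
\<close>

section \<open>Even multigraphs, cuts and Euler circuits\<close>

definition deg :: "'e set \<Rightarrow> ('e \<Rightarrow> 'v set) \<Rightarrow> 'v \<Rightarrow> nat" where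
  "deg E p v = card {e \<in> E. v \<in> p e}"

definition even_graph :: "'e set \<Rightarrow> ('e \<Rightarrow> 'v set) \<Rightarrow> bool" where
  "even_graph E p \<longleftrightarrow> finite E \<and> (\<forall>e\<in>E. card (p e) = 2) \<and> (\<forall>v. even (deg E p v))"

definition crossing :: "'e set \<Rightarrow> ('e \<Rightarrow> 'v set) \<Rightarrow> 'v set \<Rightarrow> 'e set" where
  "crossing E p X = {e \<in> E. p e \<inter> X \<noteq> {} \<and> \<not> p e \<subseteq> X}"

text \<open>
  Connectivity enters all later arguments through cuts, together with the fact that every cut of an
  even graph has an even number of edges. Hence components are defined as the minimal non-empty
  vertex sets without crossing edges, and paths are avoided. In particular, an isolated vertex forms a
  component.
\<close>

definition component :: "'e set \<Rightarrow> ('e \<Rightarrow> 'v set) \<Rightarrow> 'v set \<Rightarrow> bool" where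
  "component E p U \<longleftrightarrow> U \<noteq> {} \<and> crossing E p U = {} \<and>
     (\<forall>Y\<subseteq>U. Y \<noteq> {} \<and> crossing E p Y = {} \<longrightarrow> Y = U)"

lemma sum_deg:
  assumes "finite E" "finite X"
  shows "(\<Sum>v\<in>X. deg E p v) = (\<Sum>e\<in>E. card (p e \<inter> X))"
proof -
  have "(\<Sum>v\<in>X. card {e \<in> E. v \<in> p e}) = (\<Sum>e\<in>E. card {v \<in> X. v \<in> p e})"
    by (rule sum_multicount_gen) (use assms in auto)
  moreover have "{v \<in> X. v \<in> p e} = p e \<inter> X" for e by auto
  ultimately show ?thesis by (simp add: deg_def)
qed

lemma even_card_crossing:
  assumes "even_graph E p" "finite X"
  shows "even (card (crossing E p X))"
proof -
  have fin: "finite E" and two: "\<And>e. e \<in> E \<Longrightarrow> card (p e) = 2"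
    and ev: "\<And>v. even (deg E p v)"
    using assms(1) by (auto simp: even_graph_def)
  have "odd (card (p e \<inter> X)) \<longleftrightarrow> p e \<inter> X \<noteq> {} \<and> \<not> p e \<subseteq> X" if "e \<in> E" for e
  proof -
    obtain a b where "p e = {a, b}" "a \<noteq> b" using two[OF \<open>e \<in> E\<close>] by (meson card_2_iff)
    then show ?thesis by (cases "a \<in> X"; cases "b \<in> X") (auto simp: Int_insert_left)
  qed
  then have "crossing E p X = {e \<in> E. odd (card (p e \<inter> X))}" by (auto simp: crossing_def)
  moreover have "even (\<Sum>e\<in>E. card (p e \<inter> X))"
    using sum_deg[OF fin assms(2), of p] ev by (metis dvd_sum)
  ultimately show ?thesis using fin by (simp add: even_sum_iff)
qed

text \<open>
  The sets that no edge crosses are closed under intersection and difference, so the smallest one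
  containing \<open>w\<close> is minimal altogether.
\<close>

lemma component_within:
  assumes "w \<in> V" "crossing E p V = {}"
  obtains U where "component E p U" "w \<in> U" "U \<subseteq> V"
proof
  let ?C = "{X. crossing E p X = {} \<and> w \<in> X}"
  let ?U = "\<Inter>?C"
  show w: "w \<in> ?U" by auto
  show "?U \<subseteq> V" using assms by auto
  have cl: "crossing E p ?U = {}" by (auto simp: crossing_def)
  have "Y = ?U" if Y: "Y \<subseteq> ?U" "Y \<noteq> {}" "crossing E p Y = {}" for Y
  proof (cases "w \<in> Y")
    case True
    then show ?thesis using Y by auto
  next
    case False
    have "crossing E p (?U - Y) = {}" using cl Y by (auto simp: crossing_def)
    then have "?U \<subseteq> ?U - Y" using w False by blast
    then show ?thesis using Y by blast
  qed
  then show "component E p ?U" using w cl unfolding component_def by blast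
qed

fun trail :: "('e \<Rightarrow> 'v set) \<Rightarrow> 'v \<Rightarrow> 'e list \<Rightarrow> 'v \<Rightarrow> bool" where
  "trail p u [] v \<longleftrightarrow> u = v"
| "trail p u (e # es) v \<longleftrightarrow> (\<exists>w. w \<noteq> u \<and> p e = {u, w} \<and> trail p w es v)"

lemma trail_append:
  "trail p u (xs @ ys) v \<longleftrightarrow> (\<exists>w. trail p u xs w \<and> trail p w ys v)"
  by (induction xs arbitrary: u) auto

lemma odd_deg_trail:
  assumes "trail p u es v" "distinct es"
  shows "odd (deg (set es) p x) \<longleftrightarrow> u \<noteq> v \<and> (x = u \<or> x = v)"
  using assms
proof (induction es arbitrary: u)
  case Nil
  then show ?case by (simp add: deg_def)
next
  case (Cons e es)
  then obtain w where w: "w \<noteq> u" "p e = {u, w}" "trail p w es v" by auto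
  have "{f \<in> set (e # es). x \<in> p f} =
      (if x \<in> p e then insert e {f \<in> set es. x \<in> p f} else {f \<in> set es. x \<in> p f})" by auto
  moreover have "e \<notin> set es" using Cons.prems by auto
  ultimately have "deg (set (e # es)) p x = deg (set es) p x + (if x \<in> p e then 1 else 0)"
    by (simp add: deg_def)
  then show ?case using Cons.IH[OF w(3)] Cons.prems w by auto
qed

lemma trail_vertices:
  assumes "trail p u es v"
  shows "\<exists>vs. length vs = Suc (length es) \<and> hd vs = u \<and> last vs = v \<and>
    (\<forall>i<length es. vs ! i \<noteq> vs ! Suc i \<and> p (es ! i) = {vs ! i, vs ! Suc i})"
  using assms
proof (induction es arbitrary: u)
  case Nil
  then show ?case by (intro exI[of _ "[u]"]) auto
next
  case (Cons e es)
  then obtain w vs where w: "w \<noteq> u" "p e = {u, w}" and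
    vs: "length vs = Suc (length es)" "hd vs = w" "last vs = v"
    "\<forall>i<length es. vs ! i \<noteq> vs ! Suc i \<and> p (es ! i) = {vs ! i, vs ! Suc i}" by force
  have "vs ! 0 = w" using vs by (metis hd_conv_nth length_0_conv nat.distinct(1))
  then show ?case using w vs
    by (intro exI[of _ "u # vs"]) (auto simp: nth_Cons split: nat.splits)
qed

lemma trail_rotate:
  assumes "trail p u es u" "e \<in> set es" "x \<in> p e"
  obtains fs where "trail p x fs x" "set fs = set es" "distinct es \<Longrightarrow> distinct fs"
proof -
  obtain as bs where es: "es = as @ e # bs" using assms(2) by (meson split_list)
  then obtain a where a: "trail p u as a" "trail p a (e # bs) u"
    using assms(1) by (auto simp: trail_append)
  then obtain b where b: "p e = {a, b}" "b \<noteq> a" "trail p b bs u" by auto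
  show ?thesis
  proof (cases "x = a")
    case True
    have "trail p a ((e # bs) @ as) a" using a unfolding trail_append by blast
    then show ?thesis using that[of "(e # bs) @ as"] True es by auto
  next
    case False
    then have "x = b" using assms(3) b by auto
    moreover have "trail p b (bs @ as @ [e]) b" using a b
      by (auto simp: trail_append insert_commute)
    ultimately show ?thesis using that[of "bs @ as @ [e]"] es by auto
  qed
qed

text \<open>
  Take a longest trail. Its ends coincide, since otherwise the trail uses an odd number of the
  edges at its last vertex and can be prolonged there. If a closed longest trail misses an edge,
  then connectedness gives a missed edge at one of its vertices; rotating the trail to start at that
  vertex makes room for that edge.
\<close>

theorem euler_circuit:
  assumes g: "even_graph E p" and U: "component E p U" "\<And>e. e \<in> E \<Longrightarrow> p e \<subseteq> U"
  obtains u es where "trail p u es u" "distinct es" "set es = E"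
proof -
  have fin: "finite E" and two: "\<And>e. e \<in> E \<Longrightarrow> card (p e) = 2"
    and ev: "\<And>v. even (deg E p v)"
    using g by (auto simp: even_graph_def)
  define P where "P es \<longleftrightarrow> distinct es \<and> set es \<subseteq> E \<and> (\<exists>u v. trail p u es v)" for es
  have "P []" by (auto simp: P_def)
  moreover have "\<forall>es. P es \<longrightarrow> length es < Suc (card E)"
    using fin by (metis P_def card_mono distinct_card less_Suc_eq_le)
  ultimately obtain es where es: "P es" and max: "\<And>fs. P fs \<Longrightarrow> length fs \<le> length es"
    using ex_has_greatest_nat[of P "[]" length] by blast
  then obtain u v where t: "trail p u es v" and d: "distinct es" and sub: "set es \<subseteq> E"
    by (auto simp: P_def)
  have ext: False if "trail p a fs x" "distinct fs" "set fs = set es" "f \<in> E" "f \<notin> set es" "x \<in> p f"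
    for a fs x f
  proof -
    obtain y where "p f = {x, y}" "y \<noteq> x" using two[OF \<open>f \<in> E\<close>] \<open>x \<in> p f\<close>
      by (metis card_2_iff insertE insert_commute singletonD)
    then have "trail p a (fs @ [f]) y" using that(1) by (auto simp: trail_append)
    then have "P (fs @ [f])" using that sub by (auto simp: P_def)
    moreover have "length fs = length es" using that d by (metis distinct_card)
    ultimately show False using max by fastforce
  qed
  have uv: "u = v"
  proof (rule ccontr)
    assume "u \<noteq> v"
    then have "odd (deg (set es) p v)" using odd_deg_trail[OF t d] by simp
    then have "{e \<in> set es. v \<in> p e} \<noteq> {e \<in> E. v \<in> p e}" using ev by (metis deg_def)
    then obtain f where "f \<in> E" "f \<notin> set es" "v \<in> p f" using sub by auto
    then show False using ext[OF t d] by blast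
  qed
  have "set es = E"
  proof (rule ccontr)
    assume "set es \<noteq> E"
    then obtain f where f: "f \<in> E" "f \<notin> set es" using sub by auto
    then have "es \<noteq> []" using ext[of _ "[]"] two[OF f(1)]
      by (metis card.empty ex_in_conv trail.simps(1) zero_neq_numeral distinct.simps(1))
    define Z where "Z = (\<Union>e\<in>set es. p e)"
    have "hd es \<in> E" using \<open>es \<noteq> []\<close> sub by auto
    then have "p (hd es) \<noteq> {}" using two by fastforce
    then have "Z \<noteq> {}" using \<open>es \<noteq> []\<close> unfolding Z_def by auto
    have "\<exists>f'\<in>E. f' \<notin> set es \<and> p f' \<inter> Z \<noteq> {}"
    proof (cases "crossing E p Z = {}")
      case True
      have "Z \<subseteq> U" using U(2) sub by (auto simp: Z_def)
      then have "Z = U" using True \<open>Z \<noteq> {}\<close> U(1) by (auto simp: component_def)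
      moreover have "p f \<noteq> {}" using two[OF f(1)] by auto
      ultimately show ?thesis using f U(2)[OF f(1)] by auto
    next
      case False
      then show ?thesis by (auto simp: crossing_def Z_def)
    qed
    then obtain f' x e where f': "f' \<in> E" "f' \<notin> set es" "x \<in> p f'" "e \<in> set es" "x \<in> p e"
      by (auto simp: Z_def)
    obtain fs where "trail p x fs x" "set fs = set es" "distinct fs"
      using trail_rotate[OF t[folded uv] f'(4,5)] d by metis
    then show False using ext f' by blast
  qed
  then show ?thesis using that t d uv by blast
qed

text \<open>
  Moving the edge \<open>e\<close> to new ends \<open>A\<close> changes the parity exactly at the vertices where the old and
  the new ends differ.
\<close>

lemma deg_upd:
  assumes "finite E" "e \<in> E"
  shows "odd (deg E (p(e := A)) v) \<longleftrightarrow> (odd (deg E p v) \<noteq> ((v \<in> p e) \<noteq> (v \<in> A)))"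
proof -
  let ?D = "{f \<in> E - {e}. v \<in> p f}"
  have *: "card {f \<in> E. v \<in> q f} = card ?D + (if v \<in> q e then 1 else 0)"
    if "\<And>f. f \<noteq> e \<Longrightarrow> q f = p f" for q
  proof -
    have "{f \<in> E. v \<in> q f} = (if v \<in> q e then insert e ?D else ?D)"
      using that assms(2) by (auto split: if_splits) metis+
    then show ?thesis using assms(1) by simp
  qed
  show ?thesis using *[of p] *[of "p(e := A)"] by (auto simp: deg_def)
qed

section \<open>Even choices of pairs in a covering triple system\<close>

locale triple_cover =
  fixes V :: "'v set" and E :: "'e set" and T :: "'e \<Rightarrow> 'v set"
  assumes finite_V: "finite V" and finite_E: "finite E"
    and T_sub: "e \<in> E \<Longrightarrow> T e \<subseteq> V"
    and card_T: "e \<in> E \<Longrightarrow> card (T e) = 3"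
    and cover: "u \<in> V \<Longrightarrow> w \<in> V \<Longrightarrow> u \<noteq> w \<Longrightarrow> \<exists>e\<in>E. u \<in> T e \<and> w \<in> T e"
begin

text \<open>
  A choice keeps two of the three vertices of every triple, and so turns the triple system into a
  multigraph on \<open>V\<close>. An Euler circuit of such a multigraph is an Euler tour of the triple system.
\<close>

definition choice :: "('e \<Rightarrow> 'v set) \<Rightarrow> bool" where
  "choice p \<longleftrightarrow> (\<forall>e\<in>E. p e \<subseteq> T e \<and> card (p e) = 2)"

lemma choice_upd:
  "choice p \<Longrightarrow> A \<subseteq> T e \<Longrightarrow> card A = 2 \<Longrightarrow> choice (p(e := A))"
  by (auto simp: choice_def)

lemma T_third:
  assumes "e \<in> E" "u \<in> T e" "w \<in> T e" "u \<noteq> w"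
  obtains x where "T e = {u, w, x}" "x \<noteq> u" "x \<noteq> w" "x \<in> V" "u \<in> V" "w \<in> V"
proof -
  have "card (T e - {u, w}) = 1"
    using assms card_T[OF assms(1)] by (subst card_Diff_subset) auto
  then obtain x where x: "T e - {u, w} = {x}" by (meson card_1_singletonE)
  then have "T e = {u, w, x}" "x \<noteq> u" "x \<noteq> w" using assms by auto
  then show ?thesis using that T_sub[OF assms(1)] by auto
qed

text \<open>
  From some choice \<open>p\<close>, by re-choosing only the pairs of triples in \<open>F\<close>, one can reach every parity
  pattern on \<open>S\<close> that handshaking permits, without affecting the parity of vertices outside \<open>S\<close>.
  The intended situation is a tree on \<open>S\<close> whose edges are assigned to distinct triples of \<open>F\<close>: if the tree edge \<open>su\<close> belongs
  to the triple \<open>{s, u, w}\<close>, then exchanging \<open>{s, w}\<close> and \<open>{u, w}\<close> toggles the parity at \<open>s\<close> and at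
  \<open>u\<close>, and toggling along tree paths yields every even set.
\<close>

definition steerable :: "'v set \<Rightarrow> 'e set \<Rightarrow> bool" where
  "steerable S F \<longleftrightarrow> (\<exists>p. choice p \<and> (\<forall>D\<subseteq>S. even (card D) \<longrightarrow>
     (\<exists>q. choice q \<and> (\<forall>e\<in>E - F. q e = p e) \<and>
       (\<forall>v. odd (deg E q v) \<longleftrightarrow> (odd (deg E p v) \<noteq> (v \<in> D))))))"

lemma steerable_singleton: "steerable {x} {}"
proof -
  have "\<exists>A. A \<subseteq> T e \<and> card A = 2" if "e \<in> E" for e
    using card_T[OF that] obtain_subset_with_card_n[of 2 "T e"] by (metis Suc_leD eval_nat_numeral(3) le_refl)
  then obtain p where p: "choice p" unfolding choice_def by metis
  have "D = {}" if "D \<subseteq> {x}" "even (card D)" for D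
    using that by (auto simp: subset_singleton_iff)
  then show ?thesis unfolding steerable_def using p by (intro exI[of _ p]) auto
qed

text \<open>
  The new vertex \<open>u\<close> is a leaf attached to \<open>s\<close>: only \<open>f\<close> toggles the parity at \<open>u\<close>, and what it does
  at \<open>s\<close> is compensated inside \<open>S\<close>.
\<close>

lemma steerable_insert:
  assumes st: "steerable S F" and S: "finite S" and f: "f \<in> E" "f \<notin> F" and s: "s \<in> S" "s \<in> T f"
    and u: "u \<notin> S" "u \<in> T f"
  shows "steerable (insert u S) (insert f F)"
proof -
  have "s \<noteq> u" using s u by auto
  obtain w where w: "T f = {s, u, w}" "w \<noteq> s" "w \<noteq> u"
    using T_third[OF f(1) s(2) u(2) \<open>s \<noteq> u\<close>] by metis
  obtain p0 where p0: "choice p0" and steer: "\<And>D. D \<subseteq> S \<Longrightarrow> even (card D) \<Longrightarrow>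
     \<exists>q. choice q \<and> (\<forall>e\<in>E - F. q e = p0 e) \<and>
       (\<forall>v. odd (deg E q v) \<longleftrightarrow> (odd (deg E p0 v) \<noteq> (v \<in> D)))"
    using st unfolding steerable_def by blast
  have c: "{s, w} \<subseteq> T f" "card {s, w} = 2" "{u, w} \<subseteq> T f" "card {u, w} = 2" using w by auto
  let ?p = "p0(f := {s, w})"
  have "\<exists>q. choice q \<and> (\<forall>e\<in>E - insert f F. q e = ?p e) \<and>
      (\<forall>v. odd (deg E q v) \<longleftrightarrow> (odd (deg E ?p v) \<noteq> (v \<in> D)))"
    if D: "D \<subseteq> insert u S" "even (card D)" for D
  proof -
    have finD: "finite D" using D(1) S finite_subset by auto
    \<comment> \<open>toggling \<open>D'\<close> within \<open>S\<close>, and then \<open>s\<close> and \<open>u\<close> by means of \<open>f\<close> if \<open>u \<in> D\<close>, toggles \<open>D\<close>\<close>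
    define D' where "D' = (if u \<in> D then (D - {u} - {s}) \<union> ({s} - D) else D)"
    have "D' \<subseteq> S" using D s by (auto simp: D'_def)
    moreover have "even (card D')"
    proof (cases "u \<in> D")
      case True
      show ?thesis
      proof (cases "s \<in> D")
        case True
        then have "D = insert u (insert s D')" "u \<notin> D'" "s \<notin> D'"
          using \<open>u \<in> D\<close> \<open>s \<noteq> u\<close> by (auto simp: D'_def)
        moreover have "finite D'" using finD by (simp add: D'_def)
        ultimately show ?thesis using D(2) \<open>s \<noteq> u\<close> by auto
      next
        case False
        then have "D' = insert s (D - {u})" using \<open>u \<in> D\<close> \<open>s \<noteq> u\<close> by (auto simp: D'_def)
        then have "card D' = Suc (card (D - {u}))" using False finD by simp
        then have "card D' = card D" using card_Suc_Diff1[OF finD \<open>u \<in> D\<close>] by simp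
        then show ?thesis using D(2) by simp
      qed
    qed (simp add: D'_def D)
    ultimately obtain q where q: "choice q" "\<forall>e\<in>E - F. q e = p0 e"
      "\<And>v. odd (deg E q v) \<longleftrightarrow> (odd (deg E p0 v) \<noteq> (v \<in> D'))"
      using steer by blast
    let ?A = "if u \<in> D then {u, w} else {s, w}"
    have "choice (q(f := ?A))" using choice_upd[OF q(1)] c by auto
    moreover have "\<forall>e\<in>E - insert f F. (q(f := ?A)) e = ?p e" using q(2) by auto
    moreover have "odd (deg E (q(f := ?A)) v) \<longleftrightarrow> (odd (deg E ?p v) \<noteq> (v \<in> D))" for v
    proof -
      have "q f = p0 f" using q(2) f by auto
      then show ?thesis
        unfolding deg_upd[OF finite_E f(1)] q(3)
        using w \<open>s \<noteq> u\<close> by (auto simp: D'_def)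
    qed
    ultimately show ?thesis by blast
  qed
  moreover have "choice ?p" using choice_upd[OF p0] c by auto
  ultimately show ?thesis unfolding steerable_def by blast
qed

lemma steerable_even:
  assumes "steerable V F"
  obtains q where "choice q" "even_graph E q"
proof -
  obtain p where p: "choice p" and steer: "\<forall>D\<subseteq>V. even (card D) \<longrightarrow>
     (\<exists>q. choice q \<and> (\<forall>e\<in>E - F. q e = p e) \<and>
       (\<forall>v. odd (deg E q v) \<longleftrightarrow> (odd (deg E p v) \<noteq> (v \<in> D))))"
    using assms unfolding steerable_def by blast
  let ?D = "{v \<in> V. odd (deg E p v)}"
  have "card (p e \<inter> V) = 2" if "e \<in> E" for e
    using that p T_sub[OF that] by (metis choice_def inf.absorb1 subset_trans)
  then have "even (\<Sum>e\<in>E. card (p e \<inter> V))" by (simp add: dvd_sum)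
  then have "even (\<Sum>v\<in>V. deg E p v)" using sum_deg[OF finite_E finite_V, of p] by simp
  then have "even (card ?D)" using finite_V by (simp add: even_sum_iff)
  then have "\<exists>q. choice q \<and> (\<forall>e\<in>E - F. q e = p e) \<and>
       (\<forall>v. odd (deg E q v) \<longleftrightarrow> (odd (deg E p v) \<noteq> (v \<in> ?D)))"
    by (intro steer[rule_format]) auto
  then obtain q where "choice q \<and> (\<forall>e\<in>E - F. q e = p e) \<and>
       (\<forall>v. odd (deg E q v) \<longleftrightarrow> (odd (deg E p v) \<noteq> (v \<in> ?D)))" ..
  then have q: "choice q" "\<And>v. odd (deg E q v) \<longleftrightarrow> (odd (deg E p v) \<noteq> (v \<in> ?D))"
    by auto
  have "v \<in> V" if "odd (deg E p v)" for v
  proof (rule ccontr)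
    assume "v \<notin> V"
    then have "{e \<in> E. v \<in> p e} = {}" using p T_sub by (auto simp: choice_def)
    then show False using that unfolding deg_def by (metis card.empty even_zero)
  qed
  then have "even (deg E q v)" for v using q(2)[of v] by auto
  then show ?thesis using that q(1) finite_E by (auto simp: even_graph_def choice_def)
qed

text \<open>
  Growing the tree one vertex at a time may get stuck at the very last vertex. The remedy is to set
  aside a triple \<open>f0\<close> that will attach the vertex \<open>z\<close> at the end, and to start from a tree containing
  the other two vertices of \<open>f0\<close>. The last clause holds because a triple of \<open>F\<close> contains both ends
  of its tree edge.
\<close>

definition growing :: "'v \<Rightarrow> 'e \<Rightarrow> 'v set \<Rightarrow> 'e set \<Rightarrow> bool" where
  "growing z f0 S F \<longleftrightarrow> steerable S F \<and> S \<subseteq> V - {z} \<and> T f0 - {z} \<subseteq> S \<and> F \<subseteq> E - {f0} \<and>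
     Suc (card F) = card S \<and> (\<forall>f\<in>F. 2 \<le> card (T f \<inter> S))"

lemma two_le_card_Int:
  assumes "finite A" "u \<in> A" "w \<in> A" "u \<in> B" "w \<in> B" "u \<noteq> w"
  shows "2 \<le> card (A \<inter> B)"
proof -
  have "card {u, w} \<le> card (A \<inter> B)" using assms by (intro card_mono) auto
  then show ?thesis using assms by simp
qed

lemma finite_T: "e \<in> E \<Longrightarrow> finite (T e)"
  using card_T by (metis card.infinite zero_neq_numeral)

text \<open>
  Two vertices \<open>x\<close>, \<open>y\<close> of \<open>f0\<close> have to be joined without using \<open>f0\<close>. Either another triple contains
  both, or a vertex \<open>s\<close> outside \<open>f0\<close> is joined to \<open>x\<close> and to \<open>y\<close> by two different triples.
\<close>

lemma growing_start:
  assumes "f0 \<in> E" "f1 \<in> E" "f0 \<noteq> f1"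
  obtains z S F where "z \<in> T f0" "growing z f0 S F"
proof -
  obtain x y z where t: "T f0 = {x, y, z}" "x \<noteq> y" "y \<noteq> z" "x \<noteq> z"
    using card_T[OF assms(1)] by (auto simp: card_3_iff)
  have V: "x \<in> V" "y \<in> V" "z \<in> V" using T_sub[OF assms(1)] t by auto
  have pair: "growing z f0 {y, x} {f}" if "f \<in> E" "f \<noteq> f0" "x \<in> T f" "y \<in> T f" for f
  proof -
    have "steerable {y, x} {f}"
      using steerable_insert[OF steerable_singleton[of x], of f x y] that t by auto
    moreover have "2 \<le> card (T f \<inter> {y, x})"
      by (rule two_le_card_Int[OF finite_T[OF that(1)] that(3,4)]) (use t in auto)
    ultimately show ?thesis using that t V by (auto simp: growing_def)
  qed
  show ?thesis
  proof (cases "\<exists>f\<in>E. f \<noteq> f0 \<and> x \<in> T f \<and> y \<in> T f")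
    case True
    then show ?thesis using pair that t by blast
  next
    case False
    \<comment> \<open>a triple parallel to \<open>f0\<close> would contain \<open>x\<close> and \<open>y\<close>\<close>
    have "\<not> T f1 \<subseteq> T f0"
      using False assms t card_T by (metis card_subset_eq finite_T insertI1 insertI2)
    then obtain s where s: "s \<in> T f1" "s \<notin> T f0" by auto
    then have "s \<in> V" using T_sub assms by auto
    obtain c1 where c1: "c1 \<in> E" "x \<in> T c1" "s \<in> T c1" using cover[of x s] V \<open>s \<in> V\<close> s t by auto
    obtain c2 where c2: "c2 \<in> E" "s \<in> T c2" "y \<in> T c2" using cover[of s y] V \<open>s \<in> V\<close> s t by auto
    have ne: "c1 \<noteq> f0" "c2 \<noteq> f0" "c1 \<noteq> c2" using c1 c2 s False by auto
    have "steerable {s, x} {c1}"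
      using steerable_insert[OF steerable_singleton[of x], of c1 x s] c1 s t by auto
    then have "steerable {y, s, x} {c2, c1}"
      using steerable_insert[of "{s, x}" "{c1}" c2 s y] c2 s t ne by auto
    moreover have "2 \<le> card (T c1 \<inter> {y, s, x})"
      by (rule two_le_card_Int[OF finite_T[OF c1(1)] c1(2,3)]) (use s t in auto)
    moreover have "2 \<le> card (T c2 \<inter> {y, s, x})"
      by (rule two_le_card_Int[OF finite_T[OF c2(1)] c2(2,3)]) (use s t in auto)
    moreover have "s \<noteq> x" "s \<noteq> y" "s \<noteq> z" using s t by auto
    then have "Suc (card {c2, c1}) = card {y, s, x}" "{y, s, x} \<subseteq> V - {z}" "T f0 - {z} \<subseteq> {y, s, x}"
      using ne t V \<open>s \<in> V\<close> by auto
    moreover have "{c2, c1} \<subseteq> E - {f0}" using c1 c2 ne by auto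
    ultimately have "growing z f0 {y, s, x} {c2, c1}" unfolding growing_def by blast
    then show ?thesis using that t by blast
  qed
qed

text \<open>
  Suppose that the tree cannot grow. Then every triple that meets both \<open>S\<close> and the remaining set
  \<open>Z = V - {z} - S\<close> is already used, so it has two vertices in \<open>S\<close> and one in \<open>Z\<close>. Let \<open>u \<in> Z\<close> and
  let \<open>t\<close> be the third vertex of a triple containing \<open>z\<close> and \<open>u\<close>. This triple cannot be of the
  described kind, so \<open>t \<in> Z\<close>. The used triples containing \<open>u\<close> cover \<open>S\<close> in pairs, and so do those
  containing \<open>t\<close>; these are at least \<open>card S\<close> different triples, more than \<open>F\<close> has.
\<close>

lemma growing_step:
  assumes g: "growing z f0 S F" and z: "z \<in> T f0" "f0 \<in> E" and S: "S \<noteq> V - {z}"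
  obtains S' F' where "growing z f0 S' F'" "card S < card S'"
proof (rule ccontr)
  note found = that
  assume stuck: "\<not> thesis"
  have st: "steerable S F" and SV: "S \<subseteq> V - {z}" and f0S: "T f0 - {z} \<subseteq> S" and FE: "F \<subseteq> E - {f0}"
    and cF: "Suc (card F) = card S" and two: "\<And>f. f \<in> F \<Longrightarrow> 2 \<le> card (T f \<inter> S)"
    using g by (auto simp: growing_def)
  have finS: "finite S" using SV finite_V by (meson finite_Diff finite_subset)
  have finF: "finite F" using FE finite_E by (meson finite_Diff finite_subset)
  have zV: "z \<in> V" using T_sub z by auto
  have used: "f \<in> F" if f: "f \<in> E" "s \<in> S" "s \<in> T f" "u \<in> V - {z} - S" "u \<in> T f" for f s u
  proof (rule ccontr)
    assume "f \<notin> F"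
    have "f \<noteq> f0" using f f0S by auto
    have "steerable (insert u S) (insert f F)"
      using steerable_insert[OF st finS f(1) \<open>f \<notin> F\<close> f(2,3)] f by auto
    moreover have "2 \<le> card (T h \<inter> insert u S)" if "h \<in> F" for h
      using two[OF that] by (meson card_mono finS finite.insertI finite_Int Int_mono order_refl order_trans subset_insertI)
    moreover have "2 \<le> card (T f \<inter> insert u S)"
      by (rule two_le_card_Int[OF finite_T[OF f(1)] f(3,5)]) (use f in auto)
    moreover have "Suc (card (insert f F)) = card (insert u S)"
      using \<open>f \<notin> F\<close> f finF finS cF by simp
    ultimately have "growing z f0 (insert u S) (insert f F)"
      using FE SV f0S f \<open>f \<noteq> f0\<close> by (auto simp: growing_def)
    moreover have "card S < card (insert u S)" using f finS by simp
    ultimately show False using found stuck by blast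
  qed
  have two_out: False if fab: "f \<in> F" "a \<in> T f - S" "b \<in> T f - S" "a \<noteq> b" for f a b
  proof -
    have "f \<in> E" using fab FE by auto
    obtain x where "T f = {a, b, x}" using T_third[OF \<open>f \<in> E\<close>] fab by (metis DiffD1)
    then have "T f \<inter> S \<subseteq> {x}" using fab by auto
    then have "card (T f \<inter> S) \<le> 1" by (metis card.empty card_insert_le_m1 card_mono finite.emptyI finite.insertI is_singletonI is_singleton_altdef)
    then show False using two[OF fab(1)] by auto
  qed
  define G where "G u = {f \<in> F. u \<in> T f}" for u
  have half: "card S \<le> 2 * card (G u)" if u: "u \<in> V - {z} - S" for u
  proof -
    have "S \<subseteq> (\<Union>f\<in>G u. T f - {u})"
    proof
      fix s assume "s \<in> S"
      then obtain f where "f \<in> E" "s \<in> T f" "u \<in> T f" using cover[of s u] u SV by auto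
      then show "s \<in> (\<Union>f\<in>G u. T f - {u})" using used[of f s u] \<open>s \<in> S\<close> u by (auto simp: G_def)
    qed
    moreover have finG: "finite (G u)" using finF by (auto simp: G_def)
    moreover have "finite (\<Union>f\<in>G u. T f - {u})"
      using finG finite_T FE by (auto simp: G_def)
    ultimately have "card S \<le> card (\<Union>f\<in>G u. T f - {u})" by (intro card_mono)
    also have "\<dots> \<le> (\<Sum>f\<in>G u. card (T f - {u}))" by (rule card_UN_le[OF finG])
    also have "\<dots> = (\<Sum>f\<in>G u. 2)"
      by (rule sum.cong) (use card_T FE in \<open>auto simp: G_def\<close>)
    finally show ?thesis by simp
  qed
  obtain u where u: "u \<in> V - {z} - S" using S SV by auto
  then obtain h where h: "h \<in> E" "z \<in> T h" "u \<in> T h" using cover[of z u] zV by auto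
  then obtain t where t: "T h = {z, u, t}" "t \<noteq> z" "t \<noteq> u" "t \<in> V"
    using T_third[OF h] u by auto
  have "t \<notin> S"
  proof
    assume "t \<in> S"
    then have "h \<in> F" using used[of h t u] h t u by auto
    then show False using two_out[of h z u] h u SV by auto
  qed
  then have t': "t \<in> V - {z} - S" using t by auto
  have "G u \<inter> G t = {}" using two_out[of _ u t] u t' t by (auto simp: G_def)
  moreover have "G u \<union> G t \<subseteq> F" by (auto simp: G_def)
  ultimately have "card (G u) + card (G t) \<le> card F"
    using finF by (metis card_Un_disjoint card_mono finite_Un finite_subset)
  then show False using half[OF u] half[OF t'] cF by linarith
qed

text \<open>
  With the whole of \<open>V\<close> steerable, the set of odd vertices of the underlying choice can be toggled away,
  as its size is even by handshaking.
\<close>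

theorem even_choice_exists:
  assumes "f0 \<in> E" "f1 \<in> E" "f0 \<noteq> f1"
  obtains q where "choice q" "even_graph E q"
proof -
  obtain z S0 F0 where z: "z \<in> T f0" and g0: "growing z f0 S0 F0"
    using growing_start[OF assms] by metis
  have "\<forall>S. (\<exists>F. growing z f0 S F) \<longrightarrow> card S < Suc (card V)"
    using finite_V by (auto simp: growing_def intro!: le_imp_less_Suc card_mono)
  then obtain S F where SF: "growing z f0 S F"
    and max: "\<And>S' F'. growing z f0 S' F' \<Longrightarrow> card S' \<le> card S"
    using ex_has_greatest_nat[of "\<lambda>S. \<exists>F. growing z f0 S F" S0 card] g0 by blast
  have S: "S = V - {z}"
    using growing_step[OF SF z assms(1)] max by (metis leD)
  have z': "z \<in> V" using z T_sub assms by auto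
  have "T f0 \<noteq> {z}" using card_T[OF assms(1)] by auto
  then obtain x where "x \<in> T f0" "x \<in> S" using z SF by (auto simp: growing_def)
  moreover have "f0 \<notin> F" "steerable S F" using SF by (auto simp: growing_def)
  ultimately have "steerable (insert z S) (insert f0 F)"
    using steerable_insert[of S F f0 x z] S z finite_V assms(1) by auto
  moreover have "insert z S = V" using S z' by auto
  ultimately show ?thesis using steerable_even that by metis
qed

end

section \<open>Flipping pairs along a closed walk\<close>

text \<open>
  For vertices \<open>u\<close>, \<open>w\<close> of the triple \<open>e\<close> with \<open>p e \<noteq> {u, w}\<close>, the symmetric difference of \<open>p e\<close> and
  \<open>{u, w}\<close> is again a pair in \<open>e\<close>: exactly one of \<open>u\<close>, \<open>w\<close> belongs to \<open>p e\<close>, and it is exchanged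
  for the other one.
\<close>

definition flip :: "('e \<Rightarrow> 'v set) \<Rightarrow> 'e \<Rightarrow> 'v \<Rightarrow> 'v \<Rightarrow> 'e \<Rightarrow> 'v set" where
  "flip p e u w = p(e := (p e - {u, w}) \<union> ({u, w} - p e))"

fun flips :: "('e \<Rightarrow> 'v set) \<Rightarrow> ('e \<times> 'v \<times> 'v) list \<Rightarrow> 'e \<Rightarrow> 'v set" where
  "flips p [] = p"
| "flips p ((e, u, w) # L) = flip (flips p L) e u w"

lemma flips_other: "e \<notin> fst ` set L \<Longrightarrow> flips p L e = p e"
  by (induction p L rule: flips.induct) (auto simp: flip_def)

context triple_cover
begin

definition flippable :: "('e \<Rightarrow> 'v set) \<Rightarrow> 'e \<Rightarrow> 'v \<Rightarrow> 'v \<Rightarrow> bool" where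
  "flippable p e u w \<longleftrightarrow> e \<in> E \<and> u \<in> T e \<and> w \<in> T e \<and> u \<noteq> w \<and> p e \<noteq> {u, w}"

lemma flippable_cases:
  assumes "choice p" "flippable p e u w"
  obtains x where "T e = {u, w, x}" "x \<noteq> u" "x \<noteq> w" "p e = {u, x}" "flip p e u w = p(e := {w, x})"
  | x where "T e = {u, w, x}" "x \<noteq> u" "x \<noteq> w" "p e = {w, x}" "flip p e u w = p(e := {u, x})"
proof -
  have e: "e \<in> E" "u \<in> T e" "w \<in> T e" "u \<noteq> w" "p e \<noteq> {u, w}"
    using assms(2) by (auto simp: flippable_def)
  obtain x where x: "T e = {u, w, x}" "x \<noteq> u" "x \<noteq> w" using T_third[OF e(1-4)] by metis
  have p: "p e \<subseteq> {u, w, x}" "card (p e) = 2" using assms(1) e(1) x(1) by (auto simp: choice_def)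
  then obtain a b where ab: "p e = {a, b}" "a \<noteq> b" by (meson card_2_iff)
  then have "p e = {u, x} \<or> p e = {w, x}" using p(1) e(5) by auto
  then show ?thesis
  proof
    assume *: "p e = {u, x}"
    then have "(p e - {u, w}) \<union> ({u, w} - p e) = {w, x}" using x e by auto
    then show ?thesis using that(1)[of x] x * by (simp add: flip_def)
  next
    assume *: "p e = {w, x}"
    then have "(p e - {u, w}) \<union> ({u, w} - p e) = {u, x}" using x e by auto
    then show ?thesis using that(2)[of x] x * by (simp add: flip_def)
  qed
qed

lemma choice_flip:
  assumes "choice p" "flippable p e u w"
  shows "choice (flip p e u w)" "flip p e u w e \<inter> p e \<noteq> {}"
  using assms(2)
  by (cases rule: flippable_cases[OF assms]; use choice_upd[OF assms(1)] in auto)+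

text \<open>
  The last clause says that the pairs \<open>{u, w}\<close> of the flips sum to zero modulo 2, as the edges of a
  closed walk do; this is what keeps all degrees even.
\<close>

definition legal :: "('e \<Rightarrow> 'v set) \<Rightarrow> ('e \<times> 'v \<times> 'v) list \<Rightarrow> bool" where
  "legal p L \<longleftrightarrow> distinct (map fst L) \<and> (\<forall>(e, u, w)\<in>set L. flippable p e u w) \<and>
     (\<forall>v. even (length (filter (\<lambda>(e, u, w). v = u \<or> v = w) L)))"

lemma flips_value:
  assumes "distinct (map fst L)" "(e, u, w) \<in> set L"
  shows "flips p L e = flip p e u w e"
  using assms
proof (induction p L rule: flips.induct)
  case (2 p e' u' w' L)
  show ?case
  proof (cases "e = e'")
    case True
    then have "e \<notin> fst ` set L" using 2(2) by auto
    moreover have "u = u'" "w = w'" using 2(2,3) True by (auto simp: image_iff)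
    ultimately show ?thesis using True flips_other[of e L p] by (simp add: flip_def)
  next
    case False
    then show ?thesis using 2 by (auto simp: flip_def)
  qed
qed simp

lemma choice_flips:
  assumes "choice p" "distinct (map fst L)" "\<forall>(e, u, w)\<in>set L. flippable p e u w"
  shows "choice (flips p L)"
proof -
  have "flips p L e \<subseteq> T e \<and> card (flips p L e) = 2" if "e \<in> E" for e
  proof (cases "e \<in> fst ` set L")
    case True
    then obtain u w where "(e, u, w) \<in> set L" by auto
    then have "flips p L e = flip p e u w e" "flippable p e u w"
      using flips_value[OF assms(2)] assms(3) by blast+
    then show ?thesis using choice_flip(1)[OF assms(1)] that by (auto simp: choice_def)
  next
    case False
    then show ?thesis using assms(1) that flips_other[OF False] by (simp add: choice_def)
  qed
  then show ?thesis by (simp add: choice_def)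
qed

lemma odd_deg_flips:
  assumes "\<forall>(e, u, w)\<in>set L. e \<in> E"
  shows "odd (deg E (flips p L) v) \<longleftrightarrow>
    (odd (deg E p v) \<noteq> odd (length (filter (\<lambda>(e, u, w). v = u \<or> v = w) L)))"
  using assms
proof (induction p L rule: flips.induct)
  case (2 p e u w L)
  then have IH: "odd (deg E (flips p L) v) \<longleftrightarrow>
    (odd (deg E p v) \<noteq> odd (length (filter (\<lambda>(e, u, w). v = u \<or> v = w) L)))" and e: "e \<in> E" by auto
  have "(v \<in> A) \<noteq> (v \<in> (A - {u, w}) \<union> ({u, w} - A)) \<longleftrightarrow> v = u \<or> v = w" for A by auto
  then have "odd (deg E (flips p ((e, u, w) # L)) v) \<longleftrightarrow>
      (odd (deg E (flips p L) v) \<noteq> (v = u \<or> v = w))"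
    by (simp add: flip_def deg_upd[OF finite_E e])
  then show ?case using IH by auto
qed simp

lemma legal_flips:
  assumes "choice p" "even_graph E p" "legal p L"
  shows "choice (flips p L)" "even_graph E (flips p L)"
    "\<And>e. e \<in> E \<Longrightarrow> flips p L e \<inter> p e \<noteq> {}"
proof -
  have L: "distinct (map fst L)" "\<forall>(e, u, w)\<in>set L. flippable p e u w"
    "\<And>v. even (length (filter (\<lambda>(e, u, w). v = u \<or> v = w) L))"
    using assms(3) by (auto simp: legal_def)
  show c: "choice (flips p L)" using choice_flips[OF assms(1) L(1,2)] .
  have "\<forall>(e, u, w)\<in>set L. e \<in> E" using L(2) by (auto simp: flippable_def)
  then have "even (deg E (flips p L) v)" for v
    using odd_deg_flips[of L p v] L(3)[of v] assms(2) by (auto simp: even_graph_def)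
  then show "even_graph E (flips p L)" using c finite_E by (auto simp: even_graph_def choice_def)
  show "flips p L e \<inter> p e \<noteq> {}" if "e \<in> E" for e
  proof (cases "e \<in> fst ` set L")
    case True
    then obtain u w where "(e, u, w) \<in> set L" by auto
    then have "flips p L e = flip p e u w e" "flippable p e u w"
      using flips_value[OF L(1)] L(2) by blast+
    then show ?thesis using choice_flip(2)[OF assms(1)] by auto
  next
    case False
    have "p e \<noteq> {}" using assms(1) that by (force simp: choice_def)
    then show ?thesis using flips_other[OF False] by simp
  qed
qed

end

section \<open>A largest component contains every edge\<close>

text \<open>
  An edge (a triple with its chosen pair) lies inside \<open>U\<close> or outside, according to where its pair
  lies. A triple containing \<open>r \<notin> U\<close> and \<open>b \<in> U\<close> never has \<open>{r, b}\<close> as its pair, and hence can be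
  flipped along \<open>{r, b}\<close>. If \<open>U\<close> misses some edge, then suitable flips of such triples enlarge
  \<open>U\<close>, contrary to its maximality.
\<close>

locale largest_component = triple_cover V E T
  for V :: "'v set" and E :: "'e set" and T :: "'e \<Rightarrow> 'v set" +
  fixes p :: "'e \<Rightarrow> 'v set" and U :: "'v set"
  assumes choice_p: "choice p" and even_p: "even_graph E p"
    and comp_U: "component E p U" and U_sub: "U \<subseteq> V"
    and maximal: "\<lbrakk>choice q; even_graph E q; component E q W; W \<subseteq> V\<rbrakk> \<Longrightarrow>
      card {e \<in> E. q e \<subseteq> W} \<le> card {e \<in> E. p e \<subseteq> U}"
begin

lemma inside_or_outside: "e \<in> E \<Longrightarrow> p e \<subseteq> U \<or> p e \<inter> U = {}"
  using comp_U by (auto simp: component_def crossing_def)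

lemma p_nonempty: "e \<in> E \<Longrightarrow> p e \<noteq> {}"
  using choice_p by (force simp: choice_def)

text \<open>
  Legal flips cannot let the component of \<open>w\<close> swallow \<open>U\<close> while some edge formerly outside \<open>U\<close> ends
  at \<open>w\<close>: a flipped pair shares a vertex with the old one, so all edges inside \<open>U\<close> would be kept, and
  an edge would be gained.
\<close>

lemma stalled:
  assumes L: "legal p L" and w: "w \<in> V" and f: "f \<in> E" "p f \<inter> U = {}" "w \<in> flips p L f"
  obtains X where "crossing E (flips p L) X = {}" "w \<in> X" "\<not> U \<subseteq> X"
proof -
  note q = legal_flips[OF choice_p even_p L]
  have "crossing E (flips p L) V = {}" using q(1) T_sub by (fastforce simp: crossing_def choice_def)
  then obtain W where W: "component E (flips p L) W" "w \<in> W" "W \<subseteq> V"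
    using component_within[OF w] by metis
  have cl: "crossing E (flips p L) W = {}" using W by (simp add: component_def)
  have "\<not> U \<subseteq> W"
  proof
    assume UW: "U \<subseteq> W"
    have "flips p L e \<subseteq> W" if "e \<in> E" "p e \<subseteq> U" for e
      using q(3)[OF that(1)] that UW cl by (auto simp: crossing_def)
    moreover have "flips p L f \<subseteq> W" using f W(2) cl by (auto simp: crossing_def)
    moreover have "\<not> p f \<subseteq> U" using f p_nonempty by auto
    ultimately have "{e \<in> E. p e \<subseteq> U} \<subset> {e \<in> E. flips p L e \<subseteq> W}" using f by auto
    then have "card {e \<in> E. p e \<subseteq> U} < card {e \<in> E. flips p L e \<subseteq> W}"
      using finite_E by (intro psubset_card_mono) auto
    then show False using maximal[OF q(1,2) W(1,3)] by simp
  qed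
  then show ?thesis using that cl W by blast
qed

text \<open>
  The flips cut \<open>U\<close> into pieces only if at least two edges inside \<open>U\<close> change, since a cut of an even
  graph is even. If just two edges change, both of them cross the cut.
\<close>

lemma split_crossing:
  assumes X: "crossing E q X = {}" "X \<inter> U \<noteq> {}" "\<not> U \<subseteq> X"
    and ch: "\<And>e. e \<in> E \<Longrightarrow> p e \<subseteq> U \<Longrightarrow> q e \<noteq> p e \<Longrightarrow> e = k \<or> e = k'"
  shows "crossing E p (X \<inter> U) = {k, k'}" "k \<noteq> k'"
proof -
  let ?C = "crossing E p (X \<inter> U)"
  have "finite (X \<inter> U)" using U_sub finite_V finite_subset by blast
  then have "even (card ?C)" by (rule even_card_crossing[OF even_p])
  moreover have "?C \<noteq> {}" using comp_U X by (auto simp: component_def)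
  moreover have "?C \<subseteq> {k, k'}"
  proof
    fix e assume "e \<in> ?C"
    then have e: "e \<in> E" "p e \<inter> (X \<inter> U) \<noteq> {}" "\<not> p e \<subseteq> X \<inter> U" by (auto simp: crossing_def)
    then have "p e \<subseteq> U" using inside_or_outside by auto
    moreover have "q e \<noteq> p e" using e X(1) \<open>p e \<subseteq> U\<close> by (auto simp: crossing_def)
    ultimately show "e \<in> {k, k'}" using ch e by auto
  qed
  then have "?C = {} \<or> ?C = {k} \<or> ?C = {k'} \<or> ?C = {k, k'}" by blast
  moreover have "card {k} = 1" "card {k'} = 1" "card {k, k'} = (if k = k' then 1 else 2)" by auto
  ultimately show "?C = {k, k'}" "k \<noteq> k'" by (metis odd_one insert_absorb2)+
qed

text \<open>
  Changing at most one edge inside \<open>U\<close> does not disconnect \<open>U\<close>, so that an edge \<open>f\<close> brought from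
  outside to a vertex \<open>b\<close> of \<open>U\<close> is a net gain.
\<close>

lemma single_loss:
  assumes L: "legal p L"
    and f: "(f, r, b) \<in> set L" "p f \<inter> U = {}" "b \<in> U"
    and k: "\<And>e. e \<in> fst ` set L \<Longrightarrow> p e \<inter> U \<noteq> {} \<Longrightarrow> e = k"
  shows False
proof -
  have "flippable p f r b" using L f by (auto simp: legal_def)
  moreover have "distinct (map fst L)" using L by (simp add: legal_def)
  ultimately have fl: "f \<in> E" "flips p L f = flip p f r b f"
    using flips_value[OF _ f(1)] by (auto simp: flippable_def)
  then have "b \<in> flips p L f" using f by (auto simp: flip_def)
  then obtain X where X: "crossing E (flips p L) X = {}" "b \<in> X" "\<not> U \<subseteq> X"
    using stalled[OF L _ fl(1) f(2)] U_sub f(3) by blast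
  have "e = k \<or> e = k" if "e \<in> E" "p e \<subseteq> U" "flips p L e \<noteq> p e" for e
    using k[of e] flips_other[of e L p] that p_nonempty by blast
  then show False using split_crossing(2)[OF X(1) _ X(3)] X f(3) by blast
qed

lemma cross_cases:
  assumes "e \<in> E" "r \<in> T e" "b \<in> T e" "r \<notin> U" "b \<in> U"
  obtains x where "T e = {r, b, x}" "p e = {r, x}" "x \<noteq> r" "x \<notin> U" "p e \<inter> U = {}"
  | y where "T e = {r, b, y}" "p e = {b, y}" "y \<noteq> b" "y \<in> U" "p e \<subseteq> U"
proof -
  have fl: "flippable p e r b" using assms inside_or_outside[of e] by (auto simp: flippable_def)
  from choice_p fl show ?thesis
  proof (cases rule: flippable_cases)
    case (1 x)
    then show ?thesis using that(1)[of x] assms inside_or_outside[of e] by auto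
  next
    case (2 x)
    then show ?thesis using that(2)[of x] assms inside_or_outside[of e] by auto
  qed
qed

lemma cross_flippable:
  assumes "e \<in> E" "r \<in> T e" "b \<in> T e" "r \<notin> U" "b \<in> U"
  shows "flippable p e r b" "flippable p e b r"
  using assms inside_or_outside[of e] by (auto simp: flippable_def)

text \<open>
  Two triples through \<open>r\<close> and \<open>b\<close> can both be flipped along \<open>{r, b}\<close>, which preserves all parities and
  brings \<open>f\<close> into \<open>U\<close>.
\<close>

lemma cross_cover_unique:
  assumes "f \<in> E" "r \<in> T f" "b \<in> T f" "g \<in> E" "r \<in> T g" "b \<in> T g" "r \<notin> U" "b \<in> U" "p f \<inter> U = {}"
  shows "f = g"
proof (rule ccontr)
  assume "f \<noteq> g"
  then have "legal p [(f, r, b), (g, r, b)]"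
    using assms cross_flippable by (auto simp: legal_def)
  then show False by (rule single_loss[of _ f r b g]) (use assms in auto)
qed

text \<open>
  Flip along the triangle \<open>s\<close>, \<open>r\<close>, \<open>b\<close>. As this must not enlarge \<open>U\<close>, the edges \<open>c\<close> and \<open>d\<close> lie
  inside \<open>U\<close> and form a cut separating \<open>b\<close> from the other ends of \<open>c\<close> and \<open>d\<close>.
\<close>

lemma triangle_stalled:
  assumes e: "e \<in> E" "T e = {s, r, r'}" "T e \<inter> U = {}" "p e = {r, r'}" "s \<noteq> r" "s \<noteq> r'" "r \<noteq> r'"
    and b: "b \<in> U" and c: "c \<in> E" "s \<in> T c" "b \<in> T c" and d: "d \<in> E" "r \<in> T d" "b \<in> T d" "c \<noteq> d"
  obtains Y where "p c \<subseteq> U" "p d \<subseteq> U" "Y \<subseteq> U" "b \<notin> Y" "crossing E p Y = {c, d}"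
proof -
  have out: "s \<notin> U" "r \<notin> U" "r' \<notin> U" using e by auto
  let ?L = "[(e, s, r), (d, r, b), (c, s, b)]"
  have "e \<noteq> c" "e \<noteq> d" using e b c d by auto
  moreover have "flippable p e s r" using e by (auto simp: flippable_def doubleton_eq_iff)
  moreover have "b \<noteq> s" "b \<noteq> r" using b out by auto
  ultimately have L: "legal p ?L" using e cross_flippable[OF d(1-3) out(2) b]
      cross_flippable[OF c out(1) b] d(4) by (auto simp: legal_def)
  have c_in: "p c \<subseteq> U"
  proof (rule ccontr)
    assume "\<not> p c \<subseteq> U"
    then have "p c \<inter> U = {}" using inside_or_outside c by blast
    then show False by (intro single_loss[OF L, of c s b d]) (use b e in auto)
  qed
  have d_in: "p d \<subseteq> U"
  proof (rule ccontr)
    assume "\<not> p d \<subseteq> U"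
    then have "p d \<inter> U = {}" using inside_or_outside d by blast
    then show False by (intro single_loss[OF L, of d r b c]) (use b e in auto)
  qed
  have dist: "distinct (map fst ?L)" using L by (simp add: legal_def)
  have pe: "flips p ?L e = {s, r'}"
    using flips_value[OF dist, of e s r p] e by (auto simp: flip_def)
  obtain y where y: "p c = {b, y}" "y \<in> U" "y \<noteq> b"
    using cross_cases[OF c out(1) b] c_in p_nonempty[OF c(1)] by (metis inf.absorb1)
  have pc: "flips p ?L c = {s, y}"
    using flips_value[OF dist, of c s b p] y out b by (auto simp: flip_def)
  have "s \<in> V" using T_sub[OF e(1)] e(2) by auto
  have sp: "s \<in> flips p ?L e" and out_e: "p e \<inter> U = {}" unfolding pe using e(4) out by auto
  obtain X where X: "crossing E (flips p ?L) X = {}" "s \<in> X" "\<not> U \<subseteq> X"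
    by (rule stalled[OF L \<open>s \<in> V\<close> e(1) out_e sp])
  have "y \<in> X" using X(1,2) c(1) pc by (auto simp: crossing_def)
  have "e' = c \<or> e' = d" if "e' \<in> E" "p e' \<subseteq> U" "flips p ?L e' \<noteq> p e'" for e'
    using flips_other[of e' ?L p] that e p_nonempty[OF e(1)] by fastforce
  then have cr: "crossing E p (X \<inter> U) = {c, d}"
    using split_crossing(1)[OF X(1) _ X(3)] \<open>y \<in> X\<close> y(2) by blast
  then have "c \<in> crossing E p (X \<inter> U)" by simp
  then have "b \<notin> X" using y b \<open>y \<in> X\<close> by (auto simp: crossing_def)
  then show ?thesis using that[of "X \<inter> U"] cr c_in d_in by blast
qed

text \<open>
  In a triple \<open>{s, r1, r2}\<close> disjoint from \<open>U\<close> with the pair \<open>{r1, r2}\<close>, both triangles \<open>s\<close>, \<open>r1\<close>, \<open>b\<close>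
  and \<open>s\<close>, \<open>r2\<close>, \<open>b\<close> can be flipped. Each one yields a cut of \<open>U\<close> by two edges at \<open>b\<close>, with one edge
  \<open>c\<close> in common. Uniting the sides that avoid \<open>b\<close> gives a cut by three edges, contradicting parity.
\<close>

lemma triple_meets_U:
  assumes e: "e \<in> E"
  shows "T e \<inter> U \<noteq> {}"
proof
  assume dis: "T e \<inter> U = {}"
  have "p e \<subseteq> T e" "card (p e) = 2" using choice_p e by (auto simp: choice_def)
  then obtain r1 r2 where r: "p e = {r1, r2}" "r1 \<noteq> r2" "r1 \<in> T e" "r2 \<in> T e"
    by (auto simp: card_2_iff)
  obtain s where s: "T e = {r1, r2, s}" "s \<noteq> r1" "s \<noteq> r2" using T_third[OF e r(3,4,2)] by metis
  have V: "s \<in> V" "r1 \<in> V" "r2 \<in> V" using T_sub[OF e] s by auto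
  obtain b where b: "b \<in> U" using comp_U by (auto simp: component_def)
  have nb: "s \<noteq> b" "r1 \<noteq> b" "r2 \<noteq> b" using b dis s by auto
  have bV: "b \<in> V" using b U_sub by auto
  obtain c where c: "c \<in> E" "s \<in> T c" "b \<in> T c" using cover[OF V(1) bV nb(1)] by auto
  obtain d1 where d1: "d1 \<in> E" "r1 \<in> T d1" "b \<in> T d1" using cover[OF V(2) bV nb(2)] by auto
  obtain d2 where d2: "d2 \<in> E" "r2 \<in> T d2" "b \<in> T d2" using cover[OF V(3) bV nb(3)] by auto
  have Ts: "T e = {s, r1, r2}" "T e = {s, r2, r1}" "p e = {r2, r1}" using s r by auto
  have st1: "\<exists>Y. p c \<subseteq> U \<and> p d1 \<subseteq> U \<and> Y \<subseteq> U \<and> b \<notin> Y \<and> crossing E p Y = {c, d1}" if "c \<noteq> d1"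
    using triangle_stalled[OF e Ts(1) dis r(1) s(2,3) r(2) b c d1 that] by metis
  have st2: "\<exists>Y. p c \<subseteq> U \<and> p d2 \<subseteq> U \<and> Y \<subseteq> U \<and> b \<notin> Y \<and> crossing E p Y = {c, d2}" if "c \<noteq> d2"
    using triangle_stalled[OF e Ts(2) dis Ts(3) s(3,2) r(2)[symmetric] b c d2 that] by metis
  have "c \<noteq> d1 \<or> c \<noteq> d2"
  proof (rule ccontr)
    assume "\<not> ?thesis"
    then have "{s, r1, r2, b} \<subseteq> T c" using c d1 d2 by auto
    then have "card {s, r1, r2, b} \<le> card (T c)" using finite_T[OF c(1)] by (intro card_mono)
    then show False using card_T[OF c(1)] s r nb by auto
  qed
  then have cU: "p c \<subseteq> U" using st1 st2 by auto
  have sU: "s \<notin> U" using s dis by auto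
  obtain y where "T c = {s, b, y}" "y \<in> U"
    using cross_cases[OF c sU b] cU p_nonempty[OF c(1)] by (metis inf.absorb1)
  then have "r1 \<notin> T c" "r2 \<notin> T c" using dis s nb by auto
  then have ne: "c \<noteq> d1" "c \<noteq> d2" using d1 d2 by auto
  obtain Y1 where Y1: "Y1 \<subseteq> U" "b \<notin> Y1" "crossing E p Y1 = {c, d1}" using st1[OF ne(1)] by blast
  obtain Y2 where Y2: "Y2 \<subseteq> U" "b \<notin> Y2" "crossing E p Y2 = {c, d2}" using st2[OF ne(2)] by blast
  have dU: "d1 \<noteq> d2 \<and> b \<in> p c \<and> b \<in> p d1 \<and> b \<in> p d2"
  proof -
    have in1: "p d1 \<subseteq> U" "p d2 \<subseteq> U" using st1[OF ne(1)] st2[OF ne(2)] by auto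
    have r12: "r1 \<notin> U" "r2 \<notin> U" using s dis by auto
    obtain y1 where "T d1 = {r1, b, y1}" "p d1 = {b, y1}" "y1 \<in> U"
      using cross_cases[OF d1 r12(1) b] in1 p_nonempty[OF d1(1)] by (metis inf.absorb1)
    moreover obtain y2 where "T d2 = {r2, b, y2}" "p d2 = {b, y2}"
      using cross_cases[OF d2 r12(2) b] in1 p_nonempty[OF d2(1)] by (metis inf.absorb1)
    moreover obtain y where "p c = {b, y}"
      using cross_cases[OF c sU b] cU p_nonempty[OF c(1)] by (metis inf.absorb1)
    ultimately show ?thesis using r nb r12 by auto
  qed
  \<comment> \<open>the three edges all contain \<open>b\<close>, which lies in neither of the two sides\<close>
  have "crossing E p (Y1 \<union> Y2) = {c, d1, d2}"
  proof
    have "crossing E p (Y1 \<union> Y2) \<subseteq> crossing E p Y1 \<union> crossing E p Y2" by (auto simp: crossing_def)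
    then show "crossing E p (Y1 \<union> Y2) \<subseteq> {c, d1, d2}" using Y1 Y2 by auto
    have "c \<in> crossing E p Y1" "d1 \<in> crossing E p Y1" "d2 \<in> crossing E p Y2" using Y1 Y2 by auto
    then show "{c, d1, d2} \<subseteq> crossing E p (Y1 \<union> Y2)"
      using dU Y1(2) Y2(2) by (auto simp: crossing_def)
  qed
  then have "card (crossing E p (Y1 \<union> Y2)) = 3" using ne dU by simp
  moreover have "finite (Y1 \<union> Y2)" using Y1 Y2 U_sub finite_V finite_subset by (metis Un_least)
  ultimately show False using even_card_crossing[OF even_p, of "Y1 \<union> Y2"] by simp
qed

text \<open>
  Two vertices \<open>r\<close>, \<open>t\<close> outside \<open>U\<close> always form a spoke: every triple containing both has its third
  vertex (its apex) \<open>b\<close> in \<open>U\<close>, and then its pair must be \<open>{r, t}\<close>. In particular, the vertices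
  outside \<open>U\<close> are pairwise adjacent.
\<close>

definition spoke :: "'v \<Rightarrow> 'e \<Rightarrow> 'v \<Rightarrow> 'v \<Rightarrow> bool" where
  "spoke r e t b \<longleftrightarrow> e \<in> E \<and> r \<notin> U \<and> t \<notin> U \<and> b \<in> U \<and> r \<noteq> t \<and> T e = {r, t, b} \<and> p e = {r, t}"

lemma outer_pair:
  assumes e: "e \<in> E" "r \<in> T e" "s \<in> T e" "r \<noteq> s" "r \<notin> U" "s \<notin> U"
  obtains b where "spoke r e s b"
proof -
  obtain b where b: "T e = {r, s, b}" using T_third[OF e(1-4)] by metis
  then have "b \<in> U" using triple_meets_U[OF e(1)] e by auto
  have "b \<in> T e" using b by simp
  have "p e = {r, s}"
  proof (cases rule: cross_cases[OF e(1,2) \<open>b \<in> T e\<close> e(5) \<open>b \<in> U\<close>])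
    case (1 x)
    then have "x = s" using b e(4,6) \<open>b \<in> U\<close> by auto
    then show ?thesis using 1 by simp
  next
    case (2 y)
    then have "y \<in> {r, s, b}" using b by auto
    then show ?thesis using 2 e(5,6) by auto
  qed
  then show ?thesis using that[of b] b e \<open>b \<in> U\<close> by (auto simp: spoke_def)
qed

text \<open>
  Flip along the triangle \<open>r\<close>, \<open>b\<close>, \<open>w\<close>, where \<open>w \<in> U\<close> is the third vertex of a triple \<open>k\<close> with the
  pair \<open>{b, b'}\<close>. As \<open>U\<close> must not grow, \<open>k\<close> and \<open>f\<close> form a cut of \<open>U\<close>.
\<close>

lemma apex_pair_stalled:
  assumes e: "spoke r e t b"
    and k: "k \<in> E" "T k = {b, b', w}" "p k = {b, b'}" "w \<in> U" "b' \<in> U" "b \<noteq> b'" "w \<noteq> b" "w \<noteq> b'"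
    and f: "f \<in> E" "r \<in> T f" "w \<in> T f"
  obtains Y where "Y \<subseteq> U" "b \<in> Y" "b' \<notin> Y" "w \<notin> Y" "crossing E p Y = {k, f}" "p f \<subseteq> U"
proof -
  have s: "e \<in> E" "r \<notin> U" "t \<notin> U" "b \<in> U" "r \<noteq> t" "T e = {r, t, b}" "p e = {r, t}"
    using e by (auto simp: spoke_def)
  let ?L = "[(e, r, b), (k, b, w), (f, w, r)]"
  have "e \<noteq> k" "f \<noteq> k" "e \<noteq> f" using s k f by auto
  moreover have "flippable p k b w" using k by (auto simp: flippable_def doubleton_eq_iff)
  moreover have "w \<noteq> r" "b \<noteq> r" using s k by auto
  ultimately have L: "legal p ?L" using cross_flippable[OF s(1) _ _ s(2,4)] s
      cross_flippable[OF f s(2) k(4)] k by (auto simp: legal_def)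
  have f_in: "p f \<subseteq> U"
  proof (rule ccontr)
    assume "\<not> p f \<subseteq> U"
    then have "p f \<inter> U = {}" using inside_or_outside f by blast
    then show False by (intro single_loss[OF L, of e r b k]) (use s in auto)
  qed
  have dist: "distinct (map fst ?L)" using L by (simp add: legal_def)
  have pe: "flips p ?L e = {t, b}"
    using flips_value[OF dist, of e r b p] s by (auto simp: flip_def)
  have pk: "flips p ?L k = {b', w}"
    using flips_value[OF dist, of k b w p] k by (auto simp: flip_def)
  have "b \<in> V" using s U_sub by auto
  have sp: "b \<in> flips p ?L e" and out_e: "p e \<inter> U = {}" unfolding pe using s by auto
  obtain X where X: "crossing E (flips p ?L) X = {}" "b \<in> X" "\<not> U \<subseteq> X"
    by (rule stalled[OF L \<open>b \<in> V\<close> s(1) out_e sp])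
  have "e' = k \<or> e' = f" if "e' \<in> E" "p e' \<subseteq> U" "flips p ?L e' \<noteq> p e'" for e'
    using flips_other[of e' ?L p] that s by fastforce
  then have cr: "crossing E p (X \<inter> U) = {k, f}"
    using split_crossing(1)[OF X(1) _ X(3)] X(2) s by blast
  then have "k \<in> crossing E p (X \<inter> U)" by simp
  then have "b' \<notin> X" using k X(2) s by (auto simp: crossing_def)
  moreover have "w \<notin> X" using X(1) k(1) pk \<open>b' \<notin> X\<close> by (auto simp: crossing_def)
  ultimately show ?thesis using that[of "X \<inter> U"] cr X(2) s f_in by blast
qed

text \<open>
  Let \<open>k\<close> be a triple containing the apexes \<open>b1\<close>, \<open>b2\<close> of two spokes at \<open>r\<close>. Its pair is \<open>{b1, b2}\<close>,
  as otherwise the triangle \<open>r\<close>, \<open>b1\<close>, \<open>b2\<close> could be flipped, enlarging \<open>U\<close>. If its third vertex \<open>w\<close> were in \<open>U\<close>,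
  then each of the triangles \<open>r\<close>, \<open>b1\<close>, \<open>w\<close> and \<open>r\<close>, \<open>b2\<close>, \<open>w\<close> would yield a cut of \<open>U\<close> formed by \<open>k\<close>
  and an edge \<open>f\<close> containing \<open>w\<close>. The intersection of the sides avoiding \<open>w\<close> would be cut off by \<open>f\<close>
  alone, contradicting parity.
\<close>

lemma apex_pair:
  assumes e1: "spoke r e1 t1 b1" and e2: "spoke r e2 t2 b2" and ne: "e1 \<noteq> e2"
  obtains k w where "k \<in> E" "T k = {b1, b2, w}" "p k = {b1, b2}" "b1 \<noteq> b2"
    "w \<in> V" "w \<notin> U" "w \<noteq> r" "w \<noteq> t1" "w \<noteq> t2"
proof -
  have s1: "e1 \<in> E" "r \<notin> U" "t1 \<notin> U" "b1 \<in> U" "r \<noteq> t1" "T e1 = {r, t1, b1}" "p e1 = {r, t1}"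
    using e1 by (auto simp: spoke_def)
  have s2: "e2 \<in> E" "t2 \<notin> U" "b2 \<in> U" "r \<noteq> t2" "T e2 = {r, t2, b2}" "p e2 = {r, t2}"
    using e2 by (auto simp: spoke_def)
  have bne: "b1 \<noteq> b2"
    using cross_cover_unique[of e1 r b1 e2] s1 s2 ne by auto
  obtain k where k: "k \<in> E" "b1 \<in> T k" "b2 \<in> T k" using cover[of b1 b2] bne s1(4) s2(3) U_sub by blast
  obtain w where w: "T k = {b1, b2, w}" "w \<noteq> b1" "w \<noteq> b2" "w \<in> V" using T_third[OF k bne] by metis
  have pk: "p k = {b1, b2}"
  proof (rule ccontr)
    assume "p k \<noteq> {b1, b2}"
    then have "flippable p k b1 b2" using k bne by (auto simp: flippable_def)
    moreover have "e1 \<noteq> k" "e2 \<noteq> k" using s1 s2 k bne by auto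
    moreover have "r \<noteq> b1" "r \<noteq> b2" using s1 s2 by auto
    ultimately have "legal p [(e1, r, b1), (k, b1, b2), (e2, b2, r)]"
      using s1 s2 ne bne cross_flippable[OF s1(1) _ _ s1(2,4)] cross_flippable[OF s2(1) _ _ s1(2) s2(3)]
      by (auto simp: legal_def)
    then show False by (rule single_loss[of _ e1 r b1 k]) (use s1 s2 in auto)
  qed
  have "w \<notin> U"
  proof
    assume wU: "w \<in> U"
    then obtain f where f: "f \<in> E" "r \<in> T f" "w \<in> T f"
      using cover[of r w] s1 T_sub[OF s1(1)] w by auto
    obtain Y1 where Y1: "Y1 \<subseteq> U" "b1 \<in> Y1" "b2 \<notin> Y1" "w \<notin> Y1" "crossing E p Y1 = {k, f}" "p f \<subseteq> U"
      using apex_pair_stalled[OF e1 k(1) w(1) pk wU s2(3) bne w(2,3) f] by metis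
    have "T k = {b2, b1, w}" "p k = {b2, b1}" using w pk by auto
    then obtain Y2 where Y2: "Y2 \<subseteq> U" "b2 \<in> Y2" "b1 \<notin> Y2" "w \<notin> Y2" "crossing E p Y2 = {k, f}"
      using apex_pair_stalled[OF e2 k(1) _ _ wU s1(4) bne[symmetric] w(3,2) f] by metis
    have "k \<noteq> f" using f(2) w s1 s2 wU by auto
    obtain y where y: "p f = {w, y}"
      using cross_cases[OF f s1(2) wU] Y1(6) p_nonempty[OF f(1)] by (metis inf.absorb1)
    have "f \<in> crossing E p Y1" "f \<in> crossing E p Y2" using Y1 Y2 by auto
    then have "y \<in> Y1" "y \<in> Y2" using y Y1(4) Y2(4) by (auto simp: crossing_def)
    have "crossing E p (Y1 \<inter> Y2) = {f}"
    proof
      have "crossing E p (Y1 \<inter> Y2) \<subseteq> crossing E p Y1 \<union> crossing E p Y2" by (auto simp: crossing_def)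
      moreover have "k \<notin> crossing E p (Y1 \<inter> Y2)" using pk Y1 Y2 by (auto simp: crossing_def)
      ultimately show "crossing E p (Y1 \<inter> Y2) \<subseteq> {f}" using Y1(5) Y2(5) by auto
      show "{f} \<subseteq> crossing E p (Y1 \<inter> Y2)"
        using f y Y1(4) \<open>y \<in> Y1\<close> \<open>y \<in> Y2\<close> by (auto simp: crossing_def)
    qed
    moreover have "finite (Y1 \<inter> Y2)" using Y1 U_sub finite_V finite_subset by (metis finite_Int)
    ultimately show False using even_card_crossing[OF even_p, of "Y1 \<inter> Y2"] by simp
  qed
  have "w \<noteq> r" using cross_cover_unique[of e1 r b1 k] s1 s2 k w bne by auto
  moreover have "w \<noteq> t1" using cross_cover_unique[of e1 t1 b1 k] s1 s2 k w bne by auto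
  moreover have "w \<noteq> t2" using cross_cover_unique[of e2 t2 b2 k] s1 s2 k w bne by auto
  ultimately show ?thesis using that[of k w] k w pk bne \<open>w \<notin> U\<close> by auto
qed

text \<open>
  Flip along the quadrilateral \<open>r\<close>, \<open>b1\<close>, \<open>w\<close>, \<open>b3\<close>. If \<open>t3 \<noteq> w\<close>, then four different triples are
  available, and at most two of them, \<open>k\<close> and \<open>c\<close>, change an edge inside \<open>U\<close>. This cannot cut \<open>U\<close>,
  since the two ends \<open>b1\<close>, \<open>b2\<close> of \<open>k\<close> stay connected through \<open>t1\<close> and \<open>w\<close> by the spoke \<open>g\<close>.
\<close>

lemma third_spoke:
  assumes e1: "spoke r e1 t1 b1" and e2: "spoke r e2 t2 b2" and e3: "spoke r e3 t3 b3"
    and ne: "e1 \<noteq> e2" "e1 \<noteq> e3" "e2 \<noteq> e3"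
    and k: "k \<in> E" "T k = {b1, b2, w}" "p k = {b1, b2}"
    and w: "w \<in> V" "w \<notin> U" "w \<noteq> r" "w \<noteq> t1"
  shows "t3 = w"
proof (rule ccontr)
  assume t3: "t3 \<noteq> w"
  have s1: "e1 \<in> E" "r \<notin> U" "t1 \<notin> U" "b1 \<in> U" "r \<noteq> t1" "T e1 = {r, t1, b1}" "p e1 = {r, t1}"
    using e1 by (auto simp: spoke_def)
  have s2: "e2 \<in> E" "t2 \<notin> U" "b2 \<in> U" "r \<noteq> t2" "T e2 = {r, t2, b2}" "p e2 = {r, t2}"
    using e2 by (auto simp: spoke_def)
  have s3: "e3 \<in> E" "t3 \<notin> U" "b3 \<in> U" "r \<noteq> t3" "T e3 = {r, t3, b3}" "p e3 = {r, t3}"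
    using e3 by (auto simp: spoke_def)
  have b: "b1 \<noteq> b2" "b3 \<noteq> b1" "b3 \<noteq> b2"
    using cross_cover_unique[of e1 r b1 e2] cross_cover_unique[of e1 r b1 e3]
      cross_cover_unique[of e2 r b2 e3] s1 s2 s3 ne by auto
  obtain c where c: "c \<in> E" "w \<in> T c" "b3 \<in> T c" using cover[of w b3] w(1,2) s3(3) U_sub by blast
  let ?L = "[(e1, r, b1), (k, b1, w), (c, w, b3), (e3, b3, r)]"
  have "k \<noteq> e1" "k \<noteq> e3" using s1 s3 k b by auto
  moreover have "c \<noteq> k" using c k b s3 w by auto
  moreover have "c \<noteq> e1" using c s1 s3 b by auto
  moreover have "c \<noteq> e3" using c s3 w t3 by auto
  moreover have "w \<noteq> b1" "w \<noteq> b3" "r \<noteq> b1" "r \<noteq> b3" using w s1 s3 by auto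
  ultimately have L: "legal p ?L"
    using ne w(3) b cross_flippable[OF s1(1) _ _ s1(2,4)] s1(6)
      cross_flippable[OF s3(1) _ _ s1(2) s3(3)] s3(5)
      cross_flippable[OF k(1) _ _ w(2) s1(4)] k(2) cross_flippable[OF c w(2) s3(3)]
    by (auto simp: legal_def)
  have c_in: "p c \<subseteq> U"
  proof (rule ccontr)
    assume "\<not> p c \<subseteq> U"
    then have "p c \<inter> U = {}" using inside_or_outside c by blast
    then show False by (intro single_loss[OF L, of e1 r b1 k]) (use s1 s3 in auto)
  qed
  have dist: "distinct (map fst ?L)" using L by (simp add: legal_def)
  have pe1: "flips p ?L e1 = {t1, b1}"
    using flips_value[OF dist, of e1 r b1 p] s1 by (auto simp: flip_def)
  have pk: "flips p ?L k = {b2, w}"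
    using flips_value[OF dist, of k b1 w p] k b w s2 s1 by (auto simp: flip_def)
  obtain g where g: "g \<in> E" "t1 \<in> T g" "w \<in> T g" using cover[of t1 w] w s1 T_sub[OF s1(1)] by auto
  obtain b' where "spoke t1 g w b'" using outer_pair[OF g w(4)[symmetric] s1(3) w(2)] .
  then have pg: "p g = {t1, w}" by (simp add: spoke_def)
  have "p g \<noteq> p e1" "p g \<noteq> p e3" "p g \<noteq> p k" "\<not> p g \<subseteq> U"
    using pg s1 s3 k w t3 by (auto simp: doubleton_eq_iff)
  then have "g \<notin> fst ` set ?L" using c_in by auto
  then have g': "flips p ?L g = {t1, w}" using flips_other[of g ?L p] pg by simp
  have sp: "w \<in> flips p ?L g" and out_g: "p g \<inter> U = {}" unfolding g' using pg s1 w by auto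
  obtain X where X: "crossing E (flips p ?L) X = {}" "w \<in> X" "\<not> U \<subseteq> X"
    by (rule stalled[OF L w(1) g(1) out_g sp])
  have "t1 \<in> X" using X g(1) g' by (auto simp: crossing_def)
  then have "b1 \<in> X" using X(1) s1(1) pe1 by (auto simp: crossing_def)
  have "b2 \<in> X" using X(1,2) k(1) pk by (auto simp: crossing_def)
  have "e' = k \<or> e' = c" if "e' \<in> E" "p e' \<subseteq> U" "flips p ?L e' \<noteq> p e'" for e'
    using flips_other[of e' ?L p] that s1 s3 by fastforce
  then have "crossing E p (X \<inter> U) = {k, c}"
    using split_crossing(1)[OF X(1) _ X(3)] \<open>b1 \<in> X\<close> s1 by blast
  then have "k \<in> crossing E p (X \<inter> U)" by simp
  then show False using k \<open>b1 \<in> X\<close> \<open>b2 \<in> X\<close> s1 s2 by (auto simp: crossing_def)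
qed

text \<open>
  By parity, a vertex \<open>r\<close> outside \<open>U\<close> that has spokes \<open>h\<close>, \<open>e2\<close> and the spoke \<open>g\<close> ending at the
  vertex \<open>w\<close> of the triple \<open>k\<close> also has a fourth spoke \<open>e4\<close>. The pair \<open>h\<close>, \<open>e2\<close> forces \<open>e4\<close> to
  end at \<open>w\<close>. Likewise the pair \<open>h\<close>, \<open>g\<close> forces \<open>e4\<close> to end at a vertex \<open>w'\<close>, which differs from the
  end \<open>w\<close> of \<open>g\<close>.
\<close>

theorem all_inside:
  assumes "h \<in> E"
  shows "p h \<subseteq> U"
proof (rule ccontr)
  assume "\<not> p h \<subseteq> U"
  then have h: "p h \<inter> U = {}" using inside_or_outside assms by blast
  have p2: "p e \<subseteq> T e \<and> card (p e) = 2" if "e \<in> E" for e using choice_p that by (auto simp: choice_def)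
  obtain r where r: "r \<in> p h" using p_nonempty[OF assms] by auto
  then have rU: "r \<notin> U" using h by auto
  have sp: "\<exists>t b. spoke r e t b" if e: "e \<in> E" "r \<in> p e" for e
  proof -
    obtain t where t: "p e = {r, t}" "t \<noteq> r" using p2[OF e(1)] e(2)
      by (metis card_2_iff insertE insert_commute singletonD)
    then have "t \<notin> U" using inside_or_outside[OF e(1)] rU by auto
    moreover have "r \<in> T e" "t \<in> T e" using p2[OF e(1)] t by auto
    ultimately obtain b where "spoke r e t b" using outer_pair[OF e(1) _ _ _ rU] t(2) by metis
    then show ?thesis by blast
  qed
  have ev: "even (card {e \<in> E. r \<in> p e})" using even_p by (auto simp: even_graph_def deg_def)
  obtain t1 b1 where e1: "spoke r h t1 b1" using sp assms r by blast
  have "{e \<in> E. r \<in> p e} \<noteq> {h}" using ev by auto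
  then obtain e2 where "e2 \<in> E" "r \<in> p e2" "e2 \<noteq> h" using assms r by auto
  then obtain t2 b2 where e2: "spoke r e2 t2 b2" using sp by blast
  obtain k w where k: "k \<in> E" "T k = {b1, b2, w}" "p k = {b1, b2}"
    and w: "w \<in> V" "w \<notin> U" "w \<noteq> r" "w \<noteq> t1" "w \<noteq> t2"
    using apex_pair[OF e1 e2 \<open>e2 \<noteq> h\<close>[symmetric]] by metis
  have "r \<in> V" using T_sub[OF assms] p2[OF assms] r by auto
  then obtain g where g: "g \<in> E" "r \<in> T g" "w \<in> T g" using cover[of r w] w by auto
  then obtain b3 where e3: "spoke r g w b3" using outer_pair[OF g w(3)[symmetric] rU w(2)] by metis
  have gne: "g \<noteq> h" "g \<noteq> e2" using e1 e2 e3 w by (auto simp: spoke_def doubleton_eq_iff)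
  have "{e \<in> E. r \<in> p e} \<noteq> {h, e2, g}"
  proof
    assume "{e \<in> E. r \<in> p e} = {h, e2, g}"
    then have "even (card {h, e2, g})" using ev by simp
    then show False using gne \<open>e2 \<noteq> h\<close> by auto
  qed
  moreover have "{h, e2, g} \<subseteq> {e \<in> E. r \<in> p e}"
    using e1 e2 e3 by (auto simp: spoke_def)
  ultimately obtain e4 where e4: "e4 \<in> E" "r \<in> p e4" "e4 \<noteq> h" "e4 \<noteq> e2" "e4 \<noteq> g" by blast
  then obtain t4 b4 where s4: "spoke r e4 t4 b4" using sp by blast
  have t4: "t4 = w"
    using third_spoke[OF e1 e2 s4 _ _ _ k w(1-4)] e4 \<open>e2 \<noteq> h\<close> by auto
  obtain k' w' where k': "k' \<in> E" "T k' = {b1, b3, w'}" "p k' = {b1, b3}"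
    and w': "w' \<in> V" "w' \<notin> U" "w' \<noteq> r" "w' \<noteq> t1" "w' \<noteq> w"
    using apex_pair[OF e1 e3 gne(1)[symmetric]] by metis
  have "t4 = w'"
    using third_spoke[OF e1 e3 s4 _ _ _ k' w'(1-4)] e4 gne by auto
  then show False using t4 w' by simp
qed

end

section \<open>Euler tours of covering hypergraphs\<close>

theorem (in triple_cover) euler_circuit_exists:
  assumes "2 \<le> card E"
  obtains p u es where "choice p" "trail p u es u" "distinct es" "set es = E"
proof -
  obtain f0 f1 where f: "f0 \<in> E" "f1 \<in> E" "f0 \<noteq> f1"
    using assms by (metis card_2_iff' obtain_subset_with_card_n subsetD)
  obtain q0 where q0: "choice q0" "even_graph E q0" using even_choice_exists[OF f] by metis
  define P where "P y \<longleftrightarrow> choice (fst y) \<and> even_graph E (fst y) \<and>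
    component E (fst y) (snd y) \<and> snd y \<subseteq> V" for y :: "('e \<Rightarrow> 'v set) \<times> 'v set"
  define m where "m y = card {e \<in> E. fst y e \<subseteq> snd y}" for y :: "('e \<Rightarrow> 'v set) \<times> 'v set"
  obtain v where "v \<in> V" using card_T[OF f(1)] T_sub[OF f(1)] by fastforce
  moreover have "crossing E q0 V = {}" using q0(1) T_sub by (fastforce simp: crossing_def choice_def)
  ultimately obtain U0 where "component E q0 U0" "U0 \<subseteq> V" using component_within by metis
  then have "P (q0, U0)" using q0 by (simp add: P_def)
  moreover have "\<forall>y. P y \<longrightarrow> m y < Suc (card E)"
    using finite_E by (auto simp: m_def intro!: le_imp_less_Suc card_mono)
  ultimately obtain y where y: "P y" "\<forall>z. P z \<longrightarrow> m z \<le> m y"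
    using ex_has_greatest_nat[of P "(q0, U0)" m] by blast
  obtain p U where pU: "y = (p, U)" by (cases y)
  interpret largest_component V E T p U
  proof
    show "choice p" "even_graph E p" "component E p U" "U \<subseteq> V" using y(1) pU by (auto simp: P_def)
    fix q W assume "choice q" "even_graph E q" "component E q W" "W \<subseteq> V"
    then have "P (q, W)" by (simp add: P_def)
    then show "card {e \<in> E. q e \<subseteq> W} \<le> card {e \<in> E. p e \<subseteq> U}"
      using y(2) pU by (fastforce simp: m_def)
  qed
  obtain u es where "trail p u es u" "distinct es" "set es = E"
    using euler_circuit[OF even_p comp_U all_inside] by metis
  then show ?thesis using that choice_p by blast
qed

lemma distinct_count_list: "distinct xs \<Longrightarrow> x \<in> set xs \<Longrightarrow> count_list xs x = 1"
  by (induction xs) auto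

lemma euler_tour_mono:
  assumes "euler_tour H' vs es" "edges H' = edges H" "verts H' \<subseteq> verts H"
    "\<And>e. e \<in> edges H \<Longrightarrow> ends H' e \<subseteq> ends H e"
  shows "euler_tour H vs es"
proof -
  have "walk H' vs es" using assms(1) by (auto simp: euler_tour_def closed_walk_def)
  then have "walk H vs es" using assms(2-4) unfolding walk_def
    by (metis (no_types, lifting) nth_mem subset_iff)
  then show ?thesis using assms(1,2)
    by (auto simp: euler_tour_def closed_walk_def strict_trail_def)
qed

lemma covering_3_eulerian:
  assumes "covering_hypergraph 3 H" "2 \<le> card (edges H)"
  shows "eulerian H"
proof -
  have H: "finite (verts H)" "finite (edges H)" "\<And>e. e \<in> edges H \<Longrightarrow> ends H e \<subseteq> verts H"
    "\<And>e. e \<in> edges H \<Longrightarrow> card (ends H e) = 3"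
    "\<And>S. S \<subseteq> verts H \<Longrightarrow> card S = 2 \<Longrightarrow> \<exists>e\<in>edges H. S \<subseteq> ends H e"
    using assms(1) by (auto simp: covering_hypergraph_def hypergraph_def)
  interpret triple_cover "verts H" "edges H" "ends H"
  proof
    fix u w assume "u \<in> verts H" "w \<in> verts H" "u \<noteq> w"
    then show "\<exists>e\<in>edges H. u \<in> ends H e \<and> w \<in> ends H e" using H(5)[of "{u, w}"] by auto
  qed (use H in auto)
  obtain p u es where p: "choice p" "trail p u es u" "distinct es" "set es = edges H"
    using euler_circuit_exists[OF assms(2)] by metis
  obtain vs where vs: "length vs = Suc (length es)" "hd vs = u" "last vs = u"
    "\<And>i. i < length es \<Longrightarrow> vs ! i \<noteq> vs ! Suc i \<and> p (es ! i) = {vs ! i, vs ! Suc i}"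
    using trail_vertices[OF p(2)] by blast
  have in_ends: "vs ! i \<in> ends H (es ! i) \<and> vs ! Suc i \<in> ends H (es ! i)" if "i < length es" for i
  proof -
    have "es ! i \<in> edges H" using that p(4) nth_mem by blast
    then show ?thesis using vs(4)[OF that] p(1) unfolding choice_def by (metis insert_subset)
  qed
  have "set vs \<subseteq> verts H"
  proof
    fix v assume "v \<in> set vs"
    then obtain i where i: "i < length vs" "v = vs ! i" by (metis in_set_conv_nth)
    have "es \<noteq> []" using assms(2) p(4) by auto
    then obtain j where "j < length es" "i = j \<or> i = Suc j"
      using i(1) vs(1) by (cases i) auto
    moreover from this have "es ! j \<in> edges H" using p(4) nth_mem by blast
    ultimately show "v \<in> verts H" using in_ends[of j] H(3) i(2) by auto
  qed
  then have "walk H vs es" unfolding walk_def using vs(1,4) in_ends p(4) by auto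
  then have "euler_tour H vs es" using vs p(3,4) distinct_count_list[OF p(3)]
    by (auto simp: euler_tour_def closed_walk_def strict_trail_def)
  then show ?thesis by (auto simp: eulerian_def)
qed

text \<open>
  Delete a vertex \<open>v\<close> from the hypergraph, and an arbitrary vertex from each edge that avoids \<open>v\<close>. A set
  \<open>S\<close> of \<open>k - 1\<close> remaining vertices is still covered, namely by what is left of an edge containing
  \<open>insert v S\<close>.
\<close>

lemma covering_shrink:
  assumes "covering_hypergraph (Suc k) H" "1 \<le> k"
  obtains H' where "covering_hypergraph k H'" "edges H' = edges H" "verts H' \<subseteq> verts H"
    "\<And>e. e \<in> edges H \<Longrightarrow> ends H' e \<subseteq> ends H e"
proof -
  have H: "finite (verts H)" "finite (edges H)" "\<And>e. e \<in> edges H \<Longrightarrow> ends H e \<subseteq> verts H"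
    "\<And>e. e \<in> edges H \<Longrightarrow> card (ends H e) = Suc k" "edges H \<noteq> {}"
    "\<And>S. S \<subseteq> verts H \<Longrightarrow> card S = k \<Longrightarrow> \<exists>e\<in>edges H. S \<subseteq> ends H e"
    using assms(1) by (auto simp: covering_hypergraph_def hypergraph_def)
  obtain e0 where e0: "e0 \<in> edges H" using H(5) by auto
  then have "ends H e0 \<noteq> {}" using H(4) by fastforce
  then obtain v where v: "v \<in> verts H" using H(3)[OF e0] by auto
  have "verts H \<noteq> {v}"
  proof
    assume "verts H = {v}"
    then have "card (ends H e0) \<le> 1" using H(3)[OF e0] card_mono[of "{v}"] by auto
    then show False using H(4)[OF e0] assms(2) by simp
  qed
  define del where "del e = (if v \<in> ends H e then v else SOME x. x \<in> ends H e)" for e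
  define H' where "H' = H\<lparr>verts := verts H - {v}, ends := \<lambda>e. ends H e - {del e}\<rparr>"
  have del: "del e \<in> ends H e" if "e \<in> edges H" for e
  proof -
    have "ends H e \<noteq> {}" using H(4)[OF that] by auto
    then show ?thesis by (auto simp: del_def intro: someI)
  qed
  have "covering_hypergraph k H'"
    unfolding covering_hypergraph_def hypergraph_def
  proof (intro conjI ballI allI impI)
    show "finite (verts H')" "finite (edges H')" "edges H' \<noteq> {}" using H by (auto simp: H'_def)
    show "verts H' \<noteq> {}" using v \<open>verts H \<noteq> {v}\<close> by (auto simp: H'_def)
  next
    fix e assume "e \<in> edges H'"
    then have e: "e \<in> edges H" by (simp add: H'_def)
    then show "ends H' e \<subseteq> verts H'" using H(3)[OF e] by (auto simp: H'_def del_def)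
    show "card (ends H' e) = k" using H(4)[OF e] del[OF e] by (simp add: H'_def)
  next
    fix S assume "S \<subseteq> verts H' \<and> card S = k - 1"
    then have S: "S \<subseteq> verts H" "v \<notin> S" "card S = k - 1" by (auto simp: H'_def)
    then have "card (insert v S) = k"
      using assms(2) H(1) finite_subset by (metis Suc_diff_1 Suc_le_eq card_insert_disjoint One_nat_def)
    then obtain e where "e \<in> edges H" "insert v S \<subseteq> ends H e" using H(6)[of "insert v S"] S v by auto
    then show "\<exists>e\<in>edges H'. S \<subseteq> ends H' e" using S by (auto simp: H'_def del_def)
  qed
  then show ?thesis using that[of H'] by (auto simp: H'_def)
qed

lemma covering_eulerian:
  assumes "covering_hypergraph (n + 3) H" "2 \<le> card (edges H)"
  shows "eulerian H"
  using assms
proof (induction n arbitrary: H)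
  case 0
  then show ?case using covering_3_eulerian by simp
next
  case (Suc n)
  obtain H' where H': "covering_hypergraph (n + 3) H'" "edges H' = edges H" "verts H' \<subseteq> verts H"
    "\<And>e. e \<in> edges H \<Longrightarrow> ends H' e \<subseteq> ends H e"
    using covering_shrink[of "n + 3" H] Suc.prems(1) by auto
  then have "eulerian H'" using Suc by simp
  then show ?case using euler_tour_mono[OF _ H'(2-4)] by (auto simp: eulerian_def)
qed

lemma eulerian_two_edges:
  assumes "eulerian H" "edges H \<noteq> {}"
  shows "2 \<le> card (edges H)"
proof -
  obtain vs es where t: "euler_tour H vs es" using assms(1) by (auto simp: eulerian_def)
  then have w: "walk H vs es" "hd vs = last vs" "distinct es"
    by (auto simp: euler_tour_def closed_walk_def strict_trail_def)
  have "edges H \<subseteq> set es"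
    using t count_notin[of _ es] by (fastforce simp: euler_tour_def)
  then have set_es: "set es = edges H" using w(1) by (auto simp: walk_def)
  then have "length es = card (edges H)" using w(3) distinct_card by metis
  moreover have "length es \<noteq> 0" using set_es assms(2) by auto
  moreover have "length es \<noteq> 1"
  proof
    assume "length es = 1"
    then have "length vs = Suc (Suc 0)" "vs ! 0 \<noteq> vs ! Suc 0" using w(1) by (auto simp: walk_def)
    then show False using w(2) by (auto simp: length_Suc_conv)
  qed
  ultimately show ?thesis by linarith
qed

theorem theorem5p0p2:
  fixes k :: nat and H :: "('v, 'e) pre_hypergraph"
  assumes "k \<ge> 3" and "covering_hypergraph k H"
  shows "eulerian H \<longleftrightarrow> card (edges H) \<ge> 2"
proof
  have "edges H \<noteq> {}" using assms(2) by (simp add: covering_hypergraph_def)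
  then show "card (edges H) \<ge> 2" if "eulerian H" using eulerian_two_edges that by blast
  have "covering_hypergraph (k - 3 + 3) H" using assms by simp
  then show "eulerian H" if "card (edges H) \<ge> 2" using covering_eulerian that by blast
qed

end
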